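(* Consider the partially defined right action of $\mathrm{PGL}_2(\mathbb{Q})$ on $\mathrm{Ext}^1(\mathbb{Q},\mathbb{Z})=\mathbb{A}_f/\mathbb{Q}$ given by $$z\cdot\begin{pmatrix}a&b\\c&d\end{pmatrix}=\frac{b+dz}{a+cz}\qquad\text{whenever }a+cz\in\mathbb{A}_f^\times.$$ Then two extensions $A,A'\in\mathrm{Ext}^1(\mathbb{Q},\mathbb{Z})$ are isomorphic as abelian groups if and only if they are in the same $\mathrm{PGL}_2(\mathbb{Q})$-orbit.
   Context: $\widehat{\mathbb{Z}}=\prod_p\mathbb{Z}_p$ and $\mathbb{A}_f=\widehat{\mathbb{Z}}\otimes\mathbb{Q}$ is the ring of finite adeles; $\mathbb{A}_f/\mathbb{Q}=\widehat{\mathbb{Z}}/\mathbb{Z}$. The identification $\mathrm{Ext}^1(\mathbb{Q},\mathbb{Z})=\mathbb{A}_f/\mathbb{Q}$ sends the class of $z\in\widehat{\mathbb{Z}}$ to the class of the extension $0\to\mathbb{Z}\to A_z\to\mathbb{Q}\to0$, where $A_z=\{(u,v)\in\mathbb{Q}^2: u+zv\in\widehat{\mathbb{Z}}\}$, the first map is $n\mapsto(n,0)$ and the second is $(u,v)\mapsto v$. Two elements of $\mathbb{A}_f/\mathbb{Q}$ are in the same orbit iff they have representatives $z,z'\in\mathbb{A}_f$ such that there is $\begin{pmatrix}a&b\\c&d\end{pmatrix}\in\mathrm{GL}_2(\mathbb{Q})$ with $a+cz\in\mathbb{A}_f^\times$ and $z'=\frac{b+dz}{a+cz}$. (This condition depends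 only on the class of the matrix in $\mathrm{PGL}_2(\mathbb{Q})$.) Extensions are isomorphic as abelian groups if their middle terms are isomorphic abelian groups. *)

theory Defs
  imports
    "HOL-Algebra.Elementary_Groups"
    "HOL-Analysis.Determinants"
    "HOL-Number_Theory.Cong"
begin
text \<open>
  \<open>padic_ints p\<close> is the inverse limit of the rings \<open>\<int>/p\<^sup>k\<close>, each residue class being
  represented by its element in \<open>{0..<p\<^sup>k}\<close>.
\<close>

definition padic_ints :: "nat \<Rightarrow> (nat \<Rightarrow> int) set" where
  "padic_ints p = {x. \<forall>k. 0 \<le> x k \<and> x k < int p ^ k \<and> x (Suc k) mod int p ^ k = x k}"

text \<open>
  The elements of the product are made extensional, so that the values at non-primes carry no
  information.
\<close>

typedef zhat = "\<Pi>\<^sub>E p\<in>{p::nat. prime p}. padic_ints p"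
  morphisms component Abs_zhat
proof -
  have "(\<lambda>p\<in>{p::nat. prime p}. \<lambda>k. 0) \<in> (\<Pi>\<^sub>E p\<in>{p::nat. prime p}. padic_ints p)"
    by (auto simp: padic_ints_def prime_gt_0_nat)
  then show ?thesis by blast
qed

setup_lifting type_definition_zhat

lemma padic_ints_mod_le:
  assumes "x \<in> padic_ints p" "k \<le> l"
  shows "x l mod int p ^ k = x k"
  using assms(2)
proof (induction l rule: dec_induct)
  case base
  then show ?case using assms(1) by (simp add: padic_ints_def)
next
  case (step l)
  have "x (Suc l) mod int p ^ k = x (Suc l) mod int p ^ l mod int p ^ k"
    using step by (simp add: mod_mod_cancel le_imp_power_dvd)
  also have "\<dots> = x k" using assms(1) step by (simp add: padic_ints_def)
  finally show ?case .
qed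

lemma padic_intsI:
  assumes "prime p" "\<And>k. [f (Suc k) = f k] (mod int p ^ k)"
  shows "(\<lambda>k. f k mod int p ^ k) \<in> padic_ints p"
  using assms by (auto simp: padic_ints_def prime_gt_0_nat cong_def mod_mod_cancel)

lemma padic_ints_cong:
  assumes "x \<in> padic_ints p"
  shows "[x (Suc k) = x k] (mod int p ^ k)"
  using assms by (auto simp: padic_ints_def cong_def)

lemma component_padic: "prime p \<Longrightarrow> component x p \<in> padic_ints p"
  using component[of x] by auto

lemma component_cong:
  "prime p \<Longrightarrow> [component x p (Suc k) = component x p k] (mod int p ^ k)"
  by (intro padic_ints_cong component_padic)

lemma component_mod_self: "prime p \<Longrightarrow> component x p k mod int p ^ k = component x p k"
  using padic_ints_mod_le[OF component_padic, of p k k] by simp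

lemma zhat_eqI:
  assumes "\<And>p k. prime p \<Longrightarrow> component x p k = component y p k"
  shows "x = y"
proof -
  have "component x = component y"
    by (rule PiE_ext[OF component component]) (use assms in auto)
  then show ?thesis by (simp add: component_inject)
qed

instantiation zhat :: comm_ring_1
begin

lift_definition zero_zhat :: zhat is "\<lambda>p\<in>{p. prime p}. \<lambda>k. 0"
  by (auto simp: padic_ints_def prime_gt_0_nat)

lift_definition one_zhat :: zhat is "\<lambda>p\<in>{p. prime p}. \<lambda>k. 1 mod int p ^ k"
  by (auto intro!: padic_intsI)

lift_definition plus_zhat :: "zhat \<Rightarrow> zhat \<Rightarrow> zhat"
  is "\<lambda>x y. \<lambda>p\<in>{p. prime p}. \<lambda>k. (x p k + y p k) mod int p ^ k"
  by (intro restrict_PiE_iff[THEN iffD2] ballI padic_intsI)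
    (auto intro!: cong_add[OF padic_ints_cong padic_ints_cong])

lift_definition uminus_zhat :: "zhat \<Rightarrow> zhat"
  is "\<lambda>x. \<lambda>p\<in>{p. prime p}. \<lambda>k. (- x p k) mod int p ^ k"
  by (intro restrict_PiE_iff[THEN iffD2] ballI padic_intsI)
    (auto intro: padic_ints_cong simp: cong_minus_minus_iff)

lift_definition minus_zhat :: "zhat \<Rightarrow> zhat \<Rightarrow> zhat"
  is "\<lambda>x y. \<lambda>p\<in>{p. prime p}. \<lambda>k. (x p k - y p k) mod int p ^ k"
  by (intro restrict_PiE_iff[THEN iffD2] ballI padic_intsI)
    (auto intro!: cong_diff[OF padic_ints_cong padic_ints_cong])

lift_definition times_zhat :: "zhat \<Rightarrow> zhat \<Rightarrow> zhat"
  is "\<lambda>x y. \<lambda>p\<in>{p. prime p}. \<lambda>k. (x p k * y p k) mod int p ^ k"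
  by (intro restrict_PiE_iff[THEN iffD2] ballI padic_intsI)
    (auto intro!: cong_mult[OF padic_ints_cong padic_ints_cong])

lemmas component_simps =
  zero_zhat.rep_eq one_zhat.rep_eq plus_zhat.rep_eq uminus_zhat.rep_eq minus_zhat.rep_eq
  times_zhat.rep_eq

instance
proof
  have "component 0 2 1 \<noteq> component (1::zhat) 2 1"
    by (simp add: component_simps)
  then show "(0::zhat) \<noteq> 1" by metis
qed (auto intro!: zhat_eqI simp: component_simps component_mod_self mod_simps algebra_simps)

end

lemma component_of_int:
  assumes "prime p"
  shows "component (of_int n) p k = n mod int p ^ k"
proof -
  have nat: "component (of_nat m) p k = int m mod int p ^ k" for m
    using assms by (induction m) (auto simp: component_simps mod_simps add.commute)
  show ?thesis
    using assms by (cases n) (auto simp: component_simps nat mod_simps simp del: of_nat_Suc)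
qed

lemma zhat_torsion_free:
  fixes x :: zhat
  assumes "of_int m * x = 0" "m \<noteq> 0"
  shows "x = 0"
proof (rule zhat_eqI)
  fix p k :: nat
  assume p: "prime p"
  define e where "e = multiplicity (int p) m"
  obtain m' where m': "m = int p ^ e * m'" "\<not> int p dvd m'"
    unfolding e_def
    by (rule multiplicity_decompose'[of m "int p"])
      (use assms(2) p not_prime_unit prime_nat_int_transfer in blast)+
  have "component (of_int m * x) p (e + k) = 0"
    using p by (simp add: assms(1) component_simps)
  then have "int p ^ (e + k) dvd m * component x p (e + k)"
    using p by (simp add: component_simps component_of_int mod_simps mod_eq_0_iff_dvd)
  then have "int p ^ k dvd m' * component x p (e + k)"
    using p by (simp add: m' power_add mult.assoc prime_gt_0_nat)
  moreover have "coprime (int p ^ k) m'"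
    using p m'(2) by (simp add: prime_imp_coprime)
  ultimately have "int p ^ k dvd component x p (e + k)"
    by (simp add: coprime_dvd_mult_right_iff)
  then show "component x p k = component 0 p k"
    using padic_ints_mod_le[OF component_padic[OF p], of k "e + k" x] p
    by (simp add: component_simps)
qed

lifting_update zhat.lifting
lifting_forget zhat.lifting

text \<open>
  \<open>zhat \<otimes> \<rat>\<close> is the localization of \<open>zhat\<close> at the nonzero integers; the pair \<open>(x, m)\<close>
  stands for the fraction \<open>x / m\<close>, that is, for the tensor \<open>x \<otimes> (1/m)\<close>.
\<close>

definition adele_rel :: "zhat \<times> int \<Rightarrow> zhat \<times> int \<Rightarrow> bool" where
  "adele_rel = (\<lambda>(x, m) (y, n). m \<noteq> 0 \<and> n \<noteq> 0 \<and> of_int n * x = of_int m * y)"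

lemma zhat_cancel:
  fixes x y :: zhat
  assumes "of_int m * x = of_int m * y" "m \<noteq> 0"
  shows "x = y"
  using zhat_torsion_free[of m "x - y"] assms by (simp add: algebra_simps)

lemma part_equivp_adele_rel: "part_equivp adele_rel"
proof (rule part_equivpI)
  show "\<exists>x. adele_rel x x" by (rule exI[of _ "(0, 1)"]) (simp add: adele_rel_def)
  show "symp adele_rel" by (auto simp: symp_def adele_rel_def)
  show "transp adele_rel"
  proof (rule transpI, unfold split_paired_all)
    fix x y z m n l
    assume a: "adele_rel (x, m) (y, n)" "adele_rel (y, n) (z, l)"
    then have e: "of_int n * x = of_int m * y" "of_int l * y = of_int n * z"
      by (auto simp: adele_rel_def)
    have "of_int n * (of_int l * x) = of_int l * (of_int n * x)" by (rule mult.left_commute)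
    also have "\<dots> = of_int m * (of_int l * y)" unfolding e(1) by (rule mult.left_commute)
    also have "\<dots> = of_int n * (of_int m * z)" unfolding e(2) by (rule mult.left_commute)
    finally have "of_int n * (of_int l * x) = of_int n * (of_int m * z)" .
    then show "adele_rel (x, m) (z, l)"
      using a zhat_cancel by (auto simp: adele_rel_def)
  qed
qed

lemma adele_rel_add:
  assumes "adele_rel (x, m) (x', m')" "adele_rel (y, n) (y', n')"
  shows "adele_rel (of_int n * x + of_int m * y, m * n) (of_int n' * x' + of_int m' * y', m' * n')"
proof -
  from assms have e: "of_int m' * x = of_int m * x'" "of_int n' * y = of_int n * y'"
    by (auto simp: adele_rel_def)
  have "of_int (m' * n') * (of_int n * x + of_int m * y)
    = of_int (n * n') * (of_int m' * x) + of_int (m * m') * (of_int n' * y)"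
    by (simp add: algebra_simps)
  also have "\<dots> = of_int (m * n) * (of_int n' * x' + of_int m' * y')"
    unfolding e by (simp add: algebra_simps)
  finally show ?thesis using assms by (simp add: adele_rel_def)
qed

lemma adele_rel_mult:
  assumes "adele_rel (x, m) (x', m')" "adele_rel (y, n) (y', n')"
  shows "adele_rel (x * y, m * n) (x' * y', m' * n')"
proof -
  from assms have e: "of_int m' * x = of_int m * x'" "of_int n' * y = of_int n * y'"
    by (auto simp: adele_rel_def)
  have "of_int (m' * n') * (x * y) = (of_int m' * x) * (of_int n' * y)"
    by (simp add: ac_simps)
  also have "\<dots> = of_int (m * n) * (x' * y')"
    unfolding e by (simp add: ac_simps)
  finally show ?thesis using assms by (simp add: adele_rel_def)
qed

quotient_type finite_adele = "zhat \<times> int" / partial: adele_rel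
  by (rule part_equivp_adele_rel)

lift_definition adele_frac :: "zhat \<Rightarrow> int \<Rightarrow> finite_adele"
  is "\<lambda>x m. if m = 0 then (0, 1) else (x, m)"
  by (simp add: adele_rel_def)

instantiation finite_adele :: comm_ring_1
begin

lift_definition zero_finite_adele :: finite_adele is "(0, 1)"
  by (simp add: adele_rel_def)

lift_definition one_finite_adele :: finite_adele is "(1, 1)"
  by (simp add: adele_rel_def)

lift_definition plus_finite_adele :: "finite_adele \<Rightarrow> finite_adele \<Rightarrow> finite_adele"
  is "\<lambda>(x, m) (y, n). (of_int n * x + of_int m * y, m * n)"
  by clarify (simp only: prod.case adele_rel_add)

lift_definition uminus_finite_adele :: "finite_adele \<Rightarrow> finite_adele" is "\<lambda>(x, m). (- x, m)"
  by (auto simp: adele_rel_def)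

definition minus_finite_adele :: "finite_adele \<Rightarrow> finite_adele \<Rightarrow> finite_adele" where
  "minus_finite_adele z w = z + - w"

lift_definition times_finite_adele :: "finite_adele \<Rightarrow> finite_adele \<Rightarrow> finite_adele"
  is "\<lambda>(x, m) (y, n). (x * y, m * n)"
  by clarify (simp only: prod.case adele_rel_mult)

instance
proof
  fix z w y :: finite_adele
  show "z * w * y = z * (w * y)" "z * w = w * z" "1 * z = z" "z + w = w + z" "0 + z = z"
    "z + w + y = z + (w + y)" "(z + w) * y = z * y + w * y" "- z + z = 0"
    by (transfer; auto simp: adele_rel_def algebra_simps)+
  show "z - w = z + - w" by (rule minus_finite_adele_def)
  show "(0::finite_adele) \<noteq> 1" by transfer (simp add: adele_rel_def)
qed

end

text \<open>Division by a non-unit returns 0.\<close>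

instantiation finite_adele :: inverse
begin

definition inverse_finite_adele :: "finite_adele \<Rightarrow> finite_adele" where
  "inverse_finite_adele z = (if z dvd 1 then THE w. z * w = 1 else 0)"

definition divide_finite_adele :: "finite_adele \<Rightarrow> finite_adele \<Rightarrow> finite_adele" where
  "divide_finite_adele z w = z * inverse w"

instance ..

end

lemma adele_right_inverse:
  fixes z :: finite_adele
  assumes "z dvd 1"
  shows "z * inverse z = 1"
proof -
  obtain w where w: "z * w = 1" using assms by (metis dvdE)
  have "\<exists>!w. z * w = 1"
  proof (rule ex1I[of _ w])
    show "w' = w" if "z * w' = 1" for w'
      by (metis w that mult.assoc mult.commute mult_1)
  qed (rule w)
  from theI'[OF this] show ?thesis using assms by (simp add: inverse_finite_adele_def)
qed

lemma adele_divide_eqI: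
  fixes z w y :: finite_adele
  assumes "w dvd 1" "y * w = z"
  shows "z / w = y"
  using adele_right_inverse[OF assms(1)] assms(2)[symmetric]
  by (simp add: divide_finite_adele_def mult.assoc)

lemma adele_divide_mult:
  fixes z w :: finite_adele
  assumes "w dvd 1"
  shows "z / w * w = z"
  using adele_right_inverse[OF assms]
  by (simp add: divide_finite_adele_def mult.assoc mult.commute[of "inverse w" w])

definition adele_of_zhat :: "zhat \<Rightarrow> finite_adele" where
  "adele_of_zhat x = adele_frac x 1"

definition adele_of_rat :: "rat \<Rightarrow> finite_adele" where
  "adele_of_rat q = (case quotient_of q of (m, n) \<Rightarrow> adele_frac (of_int m) n)"

lemma adele_frac_eq_iff:
  assumes "m \<noteq> 0" "n \<noteq> 0"
  shows "adele_frac x m = adele_frac y n \<longleftrightarrow> of_int n * x = of_int m * y"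
  using assms by transfer (simp add: adele_rel_def)

lemma adele_frac_add:
  assumes "m \<noteq> 0" "n \<noteq> 0"
  shows "adele_frac x m + adele_frac y n = adele_frac (of_int n * x + of_int m * y) (m * n)"
  using assms by transfer (simp add: adele_rel_def)

lemma adele_frac_mult:
  assumes "m \<noteq> 0" "n \<noteq> 0"
  shows "adele_frac x m * adele_frac y n = adele_frac (x * y) (m * n)"
  using assms by transfer (simp add: adele_rel_def)

lemma adele_frac_cases:
  obtains x m where "z = adele_frac x m" "m > 0"
proof -
  have "\<exists>x m. z = adele_frac x m \<and> m > 0"
  proof transfer
    fix q assume q: "adele_rel q q"
    obtain x m where xm: "q = (x, m)" by (cases q)
    show "\<exists>x m. adele_rel q (if m = 0 then (0, 1) else (x, m)) \<and> m > 0"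
    proof (cases "m > 0")
      case True
      then show ?thesis using q xm by (intro exI[of _ x] exI[of _ m]) auto
    next
      case False
      then show ?thesis using q xm
        by (intro exI[of _ "- x"] exI[of _ "- m"]) (auto simp: adele_rel_def)
    qed
  qed
  then show ?thesis using that by blast
qed

lemma adele_of_rat_Fract:
  assumes "n \<noteq> 0"
  shows "adele_of_rat (Fract m n) = adele_frac (of_int m) n"
proof -
  obtain a b where ab: "quotient_of (Fract m n) = (a, b)" by (metis surj_pair)
  then have b: "b > 0" by (rule quotient_of_denom_pos)
  have "Fract m n = Fract a b"
    using quotient_of_div[OF ab] by (simp add: Fract_of_int_quotient)
  then have *: "m * b = a * n" using assms b by (simp add: eq_rat)
  have "of_int n * (of_int a :: zhat) = of_int b * of_int m"
    unfolding of_int_mult[symmetric] using * by (simp add: mult.commute)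
  then show ?thesis
    using assms b by (simp add: adele_of_rat_def ab adele_frac_eq_iff)
qed

lemma adele_of_rat_1 [simp]: "adele_of_rat 1 = 1"
  unfolding One_rat_def by (subst adele_of_rat_Fract) (simp, transfer, simp add: adele_rel_def)

lemma adele_of_rat_0 [simp]: "adele_of_rat 0 = 0"
  unfolding Zero_rat_def by (subst adele_of_rat_Fract) (simp, transfer, simp add: adele_rel_def)

lemma adele_of_rat_add: "adele_of_rat (q + r) = adele_of_rat q + adele_of_rat r"
  by (cases q; cases r) (simp add: adele_of_rat_Fract adele_frac_add mult.commute)

lemma adele_of_rat_mult: "adele_of_rat (q * r) = adele_of_rat q * adele_of_rat r"
  by (cases q; cases r) (simp add: adele_of_rat_Fract adele_frac_mult)

lemma adele_of_rat_minus: "adele_of_rat (- q) = - adele_of_rat q"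
  using adele_of_rat_add[of q "- q"] by (simp add: eq_neg_iff_add_eq_0 add.commute)

lemma adele_of_rat_diff: "adele_of_rat (q - r) = adele_of_rat q - adele_of_rat r"
  using adele_of_rat_add[of q "- r"] by (simp add: adele_of_rat_minus)

lemma adele_of_rat_unit:
  assumes "q \<noteq> 0"
  shows "adele_of_rat q dvd 1"
  by (rule dvdI[of _ _ "adele_of_rat (inverse q)"])
    (use assms in \<open>simp flip: adele_of_rat_mult\<close>)

quotient_type adele_class = finite_adele / "\<lambda>z w. \<exists>q. w - z = adele_of_rat q"
  morphisms rep_adele_class adele_class
proof (rule equivpI)
  show "reflp (\<lambda>z w. \<exists>q. w - z = adele_of_rat q)"
    by (intro reflpI exI[of _ 0]) simp
  show "symp (\<lambda>z w. \<exists>q. w - z = adele_of_rat q)"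
    by (intro sympI) (metis adele_of_rat_minus minus_diff_eq)
  show "transp (\<lambda>z w. \<exists>q. w - z = adele_of_rat q)"
    by (intro transpI) (metis adele_of_rat_add add_diff_eq diff_add_cancel)
qed

definition pgl2_rel :: "rat^2^2 \<Rightarrow> rat^2^2 \<Rightarrow> bool" where
  "pgl2_rel M N \<longleftrightarrow> invertible M \<and> invertible N \<and> (\<exists>t. t \<noteq> 0 \<and> N = mat t ** M)"

lemma mat_mult_nth: "(mat t ** M) $ i $ j = t * M $ i $ j" for M :: "rat^'n^'n"
  by (simp add: matrix_matrix_mult_def mat_def if_distrib[where f = "\<lambda>x. x * _"] cong: if_cong)

lemma part_equivp_pgl2_rel: "part_equivp pgl2_rel"
proof (rule part_equivpI)
  have "pgl2_rel (mat 1) (mat 1)"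
    unfolding pgl2_rel_def
    by (metis invertible_def matrix_mul_lid zero_neq_one)
  then show "\<exists>M. pgl2_rel M M" by blast
  show "symp pgl2_rel"
  proof (rule sympI)
    fix M N assume a: "pgl2_rel M N"
    then obtain t where t: "t \<noteq> 0" "N = mat t ** M" by (auto simp: pgl2_rel_def)
    have "M = mat (inverse t) ** N"
      using t by (auto simp: vec_eq_iff mat_mult_nth)
    then show "pgl2_rel N M" using a t(1) unfolding pgl2_rel_def by (metis inverse_nonzero_iff_nonzero)
  qed
  show "transp pgl2_rel"
  proof (rule transpI)
    fix M N K assume a: "pgl2_rel M N" "pgl2_rel N K"
    then obtain t s where t: "t \<noteq> 0" "N = mat t ** M" "s \<noteq> 0" "K = mat s ** N"
      by (auto simp: pgl2_rel_def)
    have "K = mat (s * t) ** M"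
      using t by (auto simp: vec_eq_iff mat_mult_nth)
    then show "pgl2_rel M K" using a t unfolding pgl2_rel_def by (metis mult_eq_0_iff)
  qed
qed

quotient_type pgl2_rat = "rat^2^2" / partial: pgl2_rel
  by (rule part_equivp_pgl2_rel)

text \<open>\<open>None\<close> means that the action is not defined.\<close>

lift_definition moebius :: "finite_adele \<Rightarrow> pgl2_rat \<Rightarrow> finite_adele option"
  is "\<lambda>z M.
    let a = adele_of_rat (M $ 1 $ 1); b = adele_of_rat (M $ 1 $ 2);
        c = adele_of_rat (M $ 2 $ 1); d = adele_of_rat (M $ 2 $ 2)
    in if (a + c * z) dvd 1 then Some ((b + d * z) / (a + c * z)) else None"
proof -
  fix z and M N :: "rat^2^2"
  assume "pgl2_rel M N"
  then obtain t where t: "t \<noteq> 0" "N = mat t ** M" by (auto simp: pgl2_rel_def)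
  define e where "e i j = adele_of_rat (M $ i $ j)" for i j
  define u where "u = adele_of_rat t"
  have u: "u dvd 1" using t(1) by (simp add: u_def adele_of_rat_unit)
  have N: "adele_of_rat (N $ i $ j) = u * e i j" for i j
    by (simp add: t(2) mat_mult_nth adele_of_rat_mult e_def u_def)
  have scale: "u * x + u * y * z = u * (x + y * z)" for x y by (simp add: algebra_simps)
  have unit: "u * x dvd 1 \<longleftrightarrow> x dvd 1" for x
    using u by (metis dvd_trans dvd_triv_right mult_dvd_mono mult_1)
  have quot: "(u * y) / (u * x) = y / x" if "x dvd 1" for x y
    by (rule adele_divide_eqI)
      (use that in \<open>auto simp: unit mult.left_commute[of _ u] adele_divide_mult\<close>)
  show "(let a = adele_of_rat (M $ 1 $ 1); b = adele_of_rat (M $ 1 $ 2);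
            c = adele_of_rat (M $ 2 $ 1); d = adele_of_rat (M $ 2 $ 2)
         in if (a + c * z) dvd 1 then Some ((b + d * z) / (a + c * z)) else None) =
        (let a = adele_of_rat (N $ 1 $ 1); b = adele_of_rat (N $ 1 $ 2);
            c = adele_of_rat (N $ 2 $ 1); d = adele_of_rat (N $ 2 $ 2)
         in if (a + c * z) dvd 1 then Some ((b + d * z) / (a + c * z)) else None)"
    by (simp add: Let_def N scale unit quot flip: e_def)
qed

text \<open>
  \<open>moebius\<close> does not descend to a function on classes: two classes lie in the same orbit if
  they have representatives that do.
\<close>

definition same_orbit :: "adele_class \<Rightarrow> adele_class \<Rightarrow> bool" where
  "same_orbit \<xi> \<xi>' \<longleftrightarrow>
     (\<exists>z z' g. adele_class z = \<xi> \<and> adele_class z' = \<xi>' \<and> moebius z g = Some z')"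

definition rat_group :: "rat monoid" where
  "rat_group = \<lparr>carrier = UNIV, monoid.mult = (+), one = 0\<rparr>"

definition rat_extension :: "'a monoid \<Rightarrow> (int \<Rightarrow> 'a) \<Rightarrow> ('a \<Rightarrow> rat) \<Rightarrow> bool" where
  "rat_extension A i p \<longleftrightarrow> comm_group A \<and> i \<in> mon integer_group A \<and> p \<in> epi A rat_group \<and>
     kernel A rat_group p = i ` carrier integer_group"

definition equivalent_extensions ::
  "'a monoid \<Rightarrow> (int \<Rightarrow> 'a) \<Rightarrow> ('a \<Rightarrow> rat) \<Rightarrow> 'b monoid \<Rightarrow> (int \<Rightarrow> 'b) \<Rightarrow> ('b \<Rightarrow> rat) \<Rightarrow> bool" where
  "equivalent_extensions A i p A' i' p' \<longleftrightarrow>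
     (\<exists>\<phi>\<in>iso A A'. (\<forall>n. \<phi> (i n) = i' n) \<and> (\<forall>x\<in>carrier A. p' (\<phi> x) = p x))"

definition adelic_group :: "finite_adele \<Rightarrow> (rat \<times> rat) monoid" where
  "adelic_group z =
     \<lparr>carrier = {(u, v). adele_of_rat u + z * adele_of_rat v \<in> range adele_of_zhat},
      monoid.mult = (\<lambda>(u, v) (u', v'). (u + u', v + v')), one = (0, 0)\<rparr>"

definition adelic_incl :: "int \<Rightarrow> rat \<times> rat" where
  "adelic_incl n = (of_int n, 0)"

definition adelic_proj :: "rat \<times> rat \<Rightarrow> rat" where
  "adelic_proj = snd"

text \<open>
  The identification of \<open>Ext\<^sup>1(\<rat>, \<int>)\<close> with \<open>adele_class\<close> sends the class of \<open>x\<close>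
  in \<open>zhat\<close> to the class of the extension given by \<open>adelic_group\<close>. It is a bijection, and
  \<open>ext_class\<close> is its inverse: the unique class that is sent to the given extension.
\<close>

definition ext_class :: "'a monoid \<Rightarrow> (int \<Rightarrow> 'a) \<Rightarrow> ('a \<Rightarrow> rat) \<Rightarrow> adele_class" where
  "ext_class A i p = (THE \<xi>. \<exists>x. \<xi> = adele_class (adele_of_zhat x) \<and>
     equivalent_extensions A i p (adelic_group (adele_of_zhat x)) adelic_incl adelic_proj)"

end

theory Submission
  imports Defs
begin

text \<open>
  The middle term of an extension of \<open>\<rat>\<close> by \<open>\<int>\<close> is a torsion-free group of rank two, hence a
  subgroup of \<open>\<rat>\<^sup>2\<close> once a lift of \<open>1 \<in> \<rat>\<close> has been chosen as second coordinate vector. Write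
  \<open>A\<^sub>z\<close> for \<open>adelic_group z\<close>. Collecting the residues that the lifts of the fractions \<open>1/n\<close>
  prescribe into one profinite integer \<open>x\<close> shows that the subgroup is \<open>A\<^sub>x\<close>
  (\<open>rat_plane_subgroup_eq_adelic_group\<close>, \<open>rat_extension_equivalent_adelic_group\<close>). The theorem
  is therefore a question about isomorphisms between the groups \<open>A\<^sub>z\<close>.

  A homomorphism \<open>A\<^sub>y \<rightarrow> A\<^sub>x\<close> is the restriction of a rational matrix, with rows \<open>(a, b)\<close> and
  \<open>(c, d)\<close>. It sends \<open>u + y v\<close> to \<open>(a + c x) u + (b + d x) v\<close>, and it has to preserve
  integrality. The difference \<open>(b + d x) - (a + c x) y\<close> then stays integral, up to a fixed
  denominator, after division by every integer; as \<open>zhat\<close> has no divisible elements except 0, it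
  vanishes (\<open>adelic_hom_moebius\<close>). For the identity on \<open>\<int>\<close> and on the quotient \<open>\<rat>\<close> this says
  that \<open>x - y\<close> is rational, so the class of an extension is well defined. For an isomorphism,
  multiplying \<open>a + c x\<close> by the corresponding expression for the inverse gives 1. So \<open>a + c x\<close> is a
  unit and \<open>y\<close> is the Moebius transform of \<open>x\<close>.

  Conversely, let \<open>z' = (b + d z) / w\<close> with a unit \<open>w = a + c z\<close>. Then
  \<open>w (u + z' v) = (a u + b v) + z (c u + d v)\<close>. Every unit is a rational number \<open>r\<close> times a unit
  of \<open>zhat\<close> (\<open>adele_unit_decomposition\<close>), and the unit of \<open>zhat\<close> does not affect integrality. So
  the matrix divided by \<open>r\<close> maps \<open>A\<^sub>z\<^sub>'\<close> isomorphically onto \<open>A\<^sub>z\<close>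
  (\<open>adelic_group_iso_moebius\<close>).
\<close>

section \<open>Divisibility by integers among profinite integers\<close>

lemma component_diff_of_int:
  assumes "prime p"
  shows "component (x - of_int n) p k = (component x p k - n) mod int p ^ k"
  using assms by (simp add: component_simps component_of_int mod_simps)

text \<open>
  Division by \<open>N\<close> is possible at each prime \<open>p\<close> separately. If \<open>p\<^sup>e\<close> is the exact power of \<open>p\<close> in
  \<open>N\<close>, the quotient modulo \<open>p\<^sup>k\<close> is determined by the dividend modulo \<open>p\<^sup>k\<^sup>+\<^sup>e\<close>; it exists because
  \<open>p\<^sup>e\<close> divides the dividend and the remaining factor of \<open>N\<close> is a unit.
\<close>

lemma of_int_dvd_zhat_iff:
  fixes x :: zhat
  assumes N: "N \<noteq> 0"
  shows "of_int N dvd x \<longleftrightarrow>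
    (\<forall>p k. prime p \<longrightarrow> int p ^ k dvd N \<longrightarrow> component x p k = 0)"
proof
  assume "of_int N dvd x"
  then obtain y where y: "x = of_int N * y" by (elim dvdE)
  show "\<forall>p k. prime p \<longrightarrow> int p ^ k dvd N \<longrightarrow> component x p k = 0"
  proof (intro allI impI)
    fix p k assume p: "prime p" "int p ^ k dvd N"
    then show "component x p k = 0"
      by (simp add: y component_simps component_of_int mod_simps mod_eq_0_iff_dvd)
  qed
next
  assume zero: "\<forall>p k. prime p \<longrightarrow> int p ^ k dvd N \<longrightarrow> component x p k = 0"
  define e where "e p = multiplicity (int p) N" for p
  have unit: "\<exists>m. N = int p ^ e p * m \<and> coprime (int p) m" if p: "prime p" for p
  proof -
    obtain m where "N = int p ^ e p * m" "\<not> int p dvd m"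
      unfolding e_def
      by (rule multiplicity_decompose'[of N "int p"])
        (use N p not_prime_unit prime_nat_int_transfer in blast)+
    then show ?thesis using p by (auto intro: prime_imp_coprime)
  qed
  have ex: "\<exists>s. [N * s = component x p (k + e p)] (mod int p ^ (k + e p))" if p: "prime p" for p k
  proof -
    obtain m where m: "N = int p ^ e p * m" "coprime (int p) m" using unit[OF p] by blast
    have "component x p (k + e p) mod int p ^ e p = component x p (e p)"
      by (rule padic_ints_mod_le[OF component_padic[OF p]]) simp
    also have "\<dots> = 0" using zero p by (simp add: e_def multiplicity_dvd)
    finally obtain t where t: "component x p (k + e p) = int p ^ e p * t" by (auto elim: dvdE)
    obtain r where r: "[m * r = 1] (mod int p ^ k)"
      using m(2) cong_solve_coprime_int[of m "int p ^ k"] by (auto simp: coprime_commute)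
    have "[m * (r * t) = t] (mod int p ^ k)"
      using cong_scalar_right[OF r, of t] by (simp add: mult.assoc)
    then have "int p ^ e p * int p ^ k dvd int p ^ e p * (m * (r * t) - t)"
      unfolding cong_iff_dvd_diff by (rule mult_dvd_mono[OF dvd_refl])
    then have "[N * (r * t) = component x p (k + e p)] (mod int p ^ (k + e p))"
      by (simp add: cong_iff_dvd_diff t m(1) power_add algebra_simps)
    then show ?thesis by blast
  qed
  then obtain s where
    s: "\<And>p k. prime p \<Longrightarrow> [N * s p k = component x p (k + e p)] (mod int p ^ (k + e p))"
    by metis
  \<comment> \<open>Dividing by \<open>N\<close> costs exactly \<open>e p\<close> digits; this makes the chosen quotients compatible.\<close>
  have cancel: "[a = b] (mod int p ^ k)"
    if p: "prime p" and "[N * a = N * b] (mod int p ^ (k + e p))" for p k a b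
  proof -
    obtain m where m: "N = int p ^ e p * m" "coprime (int p) m" using unit[OF p] by blast
    have "int p ^ e p * int p ^ k dvd int p ^ e p * (m * (a - b))"
      using that(2) by (simp add: cong_iff_dvd_diff m(1) power_add algebra_simps)
    then have "int p ^ k dvd m * (a - b)" using p by (simp add: prime_gt_0_nat)
    then show ?thesis
      using m(2) by (simp add: cong_iff_dvd_diff coprime_dvd_mult_right_iff)
  qed
  define y where "y = Abs_zhat (\<lambda>p\<in>{p. prime p}. \<lambda>k. s p k mod int p ^ k)"
  have "(\<lambda>p\<in>{p. prime p}. \<lambda>k. s p k mod int p ^ k) \<in> (\<Pi>\<^sub>E p\<in>{p::nat. prime p}. padic_ints p)"
  proof (intro restrict_PiE_iff[THEN iffD2] ballI padic_intsI)
    fix p k assume "p \<in> {p::nat. prime p}"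
    then have p: "prime p" by simp
    have "[N * s p (Suc k) = component x p (Suc (k + e p))] (mod int p ^ (k + e p))"
      using cong_dvd_modulus[OF s[OF p, of "Suc k"], of "int p ^ (k + e p)"] by simp
    also have "[component x p (Suc (k + e p)) = component x p (k + e p)] (mod int p ^ (k + e p))"
      by (rule component_cong[OF p])
    also have "[component x p (k + e p) = N * s p k] (mod int p ^ (k + e p))"
      by (rule cong_sym[OF s[OF p]])
    finally show "[s p (Suc k) = s p k] (mod int p ^ k)" by (rule cancel[OF p])
  qed auto
  then have y: "component y p k = s p k mod int p ^ k" if "prime p" for p k
    using that by (simp add: y_def Abs_zhat_inverse)
  have "x = of_int N * y"
  proof (rule zhat_eqI)
    fix p k :: nat assume p: "prime p"
    have "[N * s p k = component x p (k + e p)] (mod int p ^ k)"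
      using cong_dvd_modulus[OF s[OF p, of k], of "int p ^ k"] by (simp add: power_add)
    then have "N * s p k mod int p ^ k = component x p k"
      using padic_ints_mod_le[OF component_padic[OF p], of k "k + e p" x] by (simp add: cong_def)
    then show "component x p k = component (of_int N * y) p k"
      using p by (simp add: component_simps component_of_int y mod_simps)
  qed
  then show "of_int N dvd x" by simp
qed

lemma zhat_of_int_dvd_of_int:
  assumes "of_int n dvd (of_int m :: zhat)" "n \<noteq> 0"
  shows "n dvd m"
proof (cases "m = 0")
  case False
  show ?thesis
  proof (rule multiplicity_le_imp_dvd)
    fix q :: int assume q: "prime q"
    define p where "p = nat q"
    have p: "prime p" "q = int p" using q prime_ge_0_int[OF q] by (auto simp: p_def)
    have "component (of_int m) p (multiplicity q n) = 0"
      using assms p by (simp add: of_int_dvd_zhat_iff multiplicity_dvd)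
    then have "q ^ multiplicity q n dvd m" using p by (simp add: component_of_int mod_eq_0_iff_dvd)
    then show "multiplicity q n \<le> multiplicity q m"
      using False q by (intro multiplicity_geI) auto
  qed (use assms in auto)
qed auto

text \<open>
  Divisibility by all powers of \<open>p\<close> forces every \<open>p\<close>-adic digit to vanish. This separatedness is
  what turns integrality conditions into exact equations below.
\<close>

lemma zhat_divisible_eq_0:
  fixes x :: zhat
  assumes "\<And>n. n > 0 \<Longrightarrow> of_int n dvd x"
  shows "x = 0"
proof (rule zhat_eqI)
  fix p k :: nat assume p: "prime p"
  have "of_int (int p ^ k) dvd x" by (intro assms) (simp add: p prime_gt_0_nat)
  then show "component x p k = component 0 p k"
    using p of_int_dvd_zhat_iff[of "int p ^ k" x] by (simp add: component_simps prime_gt_0_nat)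
qed

text \<open>
  The Chinese remainder theorem in the limit: \<open>zhat\<close> is complete for the topology given by the
  integers. The residues modulo prime powers are the components of the limit.
\<close>

lemma zhat_of_compatible_residues:
  fixes c :: "int \<Rightarrow> int"
  assumes c: "\<And>m n. 0 < m \<Longrightarrow> 0 < n \<Longrightarrow> m dvd n \<Longrightarrow> [c n = c m] (mod m)"
  shows "\<exists>x::zhat. \<forall>n>0. of_int n dvd x - of_int (c n)"
proof -
  define x where "x = Abs_zhat (\<lambda>p\<in>{p. prime p}. \<lambda>k. c (int p ^ k) mod int p ^ k)"
  have "(\<lambda>p\<in>{p. prime p}. \<lambda>k. c (int p ^ k) mod int p ^ k) \<in>
      (\<Pi>\<^sub>E p\<in>{p::nat. prime p}. padic_ints p)"
    by (intro restrict_PiE_iff[THEN iffD2] ballI padic_intsI) (auto intro!: c simp: prime_gt_0_nat)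
  then have x: "component x p k = c (int p ^ k) mod int p ^ k" if "prime p" for p k
    using that by (simp add: x_def Abs_zhat_inverse)
  have "of_int n dvd x - of_int (c n)" if n: "n > 0" for n
  proof -
    have "component (x - of_int (c n)) p k = 0" if p: "prime p" "int p ^ k dvd n" for p k
    proof -
      have "[c n = c (int p ^ k)] (mod int p ^ k)"
        using p n by (intro c) (auto simp: prime_gt_0_nat)
      then have "(c (int p ^ k) - c n) mod int p ^ k = 0"
        by (simp add: cong_iff_dvd_diff dvd_diff_commute mod_eq_0_iff_dvd)
      then show ?thesis using p(1) by (simp add: component_diff_of_int x mod_simps)
    qed
    then show ?thesis using n by (subst of_int_dvd_zhat_iff) auto
  qed
  then show ?thesis by blast
qed

text \<open>
  Density of the integers. For a prime, the first \<open>p\<close>-adic digit is the required residue; the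
  general case composes the approximations along the prime factors of \<open>N\<close>.
\<close>

lemma zhat_approx_int:
  fixes x :: zhat
  assumes "N > 0"
  shows "\<exists>n. of_int (int N) dvd x - of_int n"
  using assms
proof (induction N arbitrary: x rule: prime_divisors_induct)
  case (factor p N)
  define k where "k = component x p 1"
  have "\<forall>q j. prime q \<longrightarrow> int q ^ j dvd int p \<longrightarrow> component (x - of_int k) q j = 0"
  proof (intro allI impI)
    fix q j assume q: "prime q" "int q ^ j dvd int p"
    then have "q ^ j dvd p" by (metis of_nat_dvd_iff of_nat_power)
    then have "q ^ j = 1 \<or> q ^ j = p"
      using factor.hyps by (auto simp: prime_nat_iff)
    then have "j = 0 \<or> (q = p \<and> j = 1)"
      using q(1) factor.hyps by (auto simp: prime_power_iff)
    then show "component (x - of_int k) q j = 0"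
      using q(1) padic_ints_mod_le[OF component_padic[OF q(1)], of 0 0 x]
      by (auto simp: component_diff_of_int k_def)
  qed
  then have "of_int (int p) dvd x - of_int k"
    using factor.hyps by (subst of_int_dvd_zhat_iff) auto
  then obtain y where y: "x - of_int k = of_int (int p) * y" by (elim dvdE)
  obtain n where "of_int (int N) dvd y - of_int n" using factor by fastforce
  then have "of_int (int p) * of_int (int N) dvd of_int (int p) * (y - of_int n)"
    by (rule mult_dvd_mono[OF dvd_refl])
  then have "of_int (int (p * N)) dvd x - of_int (k + int p * n)"
    using y by (simp add: algebra_simps)
  then show ?case by blast
qed (auto intro: exI[of _ 0])

lemma zhat_of_int_dvd: "n dvd m \<Longrightarrow> (of_int n :: zhat) dvd of_int m"
  by (auto elim!: dvdE)

text \<open>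
  An ideal of \<open>zhat\<close> generated by a divisor of \<open>N\<close> is already generated by an integer: replace
  \<open>x\<close> by an integer \<open>k\<close> congruent to it modulo \<open>N\<close>, then \<open>x\<close> and \<open>gcd k N\<close> divide each other. The
  quotient is a unit as \<open>zhat\<close> has no torsion.
\<close>

lemma zhat_dvd_int_associate:
  fixes x :: zhat
  assumes "x dvd of_int N" "N > 0"
  shows "\<exists>n \<epsilon>. n \<noteq> 0 \<and> \<epsilon> dvd 1 \<and> x = of_int n * \<epsilon>"
proof -
  obtain k where k: "of_int N dvd x - of_int k"
    using zhat_approx_int[of "nat N" x] assms(2) by auto
  define n where "n = gcd k N"
  have n: "n \<noteq> 0" using assms(2) by (simp add: n_def)
  have "(of_int n :: zhat) dvd of_int k" "(of_int n :: zhat) dvd of_int N"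
    by (auto simp: n_def intro!: zhat_of_int_dvd)
  then have "of_int n dvd x" using k by (metis dvd_add diff_add_cancel dvd_trans)
  then obtain \<epsilon> where \<epsilon>: "x = of_int n * \<epsilon>" by (elim dvdE)
  obtain r s where "n = r * k + s * N" unfolding n_def by (metis bezout_int)
  then have "of_int n = of_int r * x - of_int r * (x - of_int k) + of_int s * of_int N"
    by (simp add: algebra_simps)
  moreover have "x dvd x - of_int k" using assms(1) k by (rule dvd_trans)
  ultimately have "x dvd of_int n" using assms(1) by (auto intro!: dvd_add dvd_diff)
  then obtain \<delta> where "of_int n = x * \<delta>" by (elim dvdE)
  then have "of_int n * (\<epsilon> * \<delta>) = of_int n * 1" by (simp add: \<epsilon> mult.assoc)
  then have "\<epsilon> * \<delta> = 1" using n by (rule zhat_cancel)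
  then show ?thesis using n \<epsilon> by (metis dvdI)
qed

section \<open>Integral elements and units of the finite adeles\<close>

lemma adele_of_zhat_add: "adele_of_zhat (x + y) = adele_of_zhat x + adele_of_zhat y"
  by (simp add: adele_of_zhat_def adele_frac_add)

lemma adele_of_zhat_mult: "adele_of_zhat (x * y) = adele_of_zhat x * adele_of_zhat y"
  by (simp add: adele_of_zhat_def adele_frac_mult)

lemma adele_of_rat_of_int: "adele_of_rat (of_int n) = adele_of_zhat (of_int n)"
  by (simp add: adele_of_zhat_def adele_of_rat_Fract of_int_rat)

lemma adele_of_zhat_0 [simp]: "adele_of_zhat 0 = 0"
  using adele_of_zhat_add[of 0 0] by simp

lemma adele_of_zhat_1 [simp]: "adele_of_zhat 1 = 1"
  using adele_of_rat_of_int[of 1] by simp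

lemma adele_of_zhat_minus: "adele_of_zhat (- x) = - adele_of_zhat x"
  using adele_of_zhat_add[of x "- x"] by (simp add: eq_neg_iff_add_eq_0 add.commute)

lemma inj_adele_of_zhat: "inj adele_of_zhat"
  by (rule injI) (simp add: adele_of_zhat_def adele_frac_eq_iff)

abbreviation integral_adele :: "finite_adele \<Rightarrow> bool" where
  "integral_adele z \<equiv> z \<in> range adele_of_zhat"

lemma integral_adele_add: "integral_adele z \<Longrightarrow> integral_adele w \<Longrightarrow> integral_adele (z + w)"
  by (auto simp flip: adele_of_zhat_add)

lemma integral_adele_minus: "integral_adele z \<Longrightarrow> integral_adele (- z)"
  by (auto simp flip: adele_of_zhat_minus)

lemma integral_adele_diff: "integral_adele z \<Longrightarrow> integral_adele w \<Longrightarrow> integral_adele (z - w)"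
  using integral_adele_add[of z "- w"] integral_adele_minus[of w] by simp

lemma integral_adele_mult: "integral_adele z \<Longrightarrow> integral_adele w \<Longrightarrow> integral_adele (z * w)"
  by (auto simp flip: adele_of_zhat_mult)

lemma integral_adele_of_int: "integral_adele (adele_of_rat (of_int n))"
  by (simp add: adele_of_rat_of_int)

lemma adele_frac_eq:
  assumes "m \<noteq> 0"
  shows "adele_frac x m = adele_of_rat (1 / of_int m) * adele_of_zhat x"
proof -
  have "adele_of_rat (Fract 1 m) * adele_of_zhat x = adele_frac x m"
    using assms by (simp add: adele_of_zhat_def adele_of_rat_Fract adele_frac_mult)
  then show ?thesis by (simp add: Fract_of_int_quotient)
qed

text \<open>
  \<open>\<rat> \<inter> zhat = \<int>\<close>, since an integer divides another one in \<open>zhat\<close> only if it does so in \<open>\<int>\<close>.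
\<close>

lemma integral_adele_of_rat_iff: "integral_adele (adele_of_rat u) \<longleftrightarrow> u \<in> \<int>"
proof
  assume "integral_adele (adele_of_rat u)"
  then obtain y where y: "adele_of_rat u = adele_of_zhat y" by blast
  obtain m n where mn: "u = Fract m n" "n > 0" by (cases u) auto
  then have "of_int m = of_int n * y"
    using y by (simp add: adele_of_rat_Fract adele_of_zhat_def adele_frac_eq_iff)
  then have "n dvd m" using mn(2) by (intro zhat_of_int_dvd_of_int) auto
  then obtain k where "m = n * k" by (elim dvdE)
  then have "u = of_int k" using mn by (simp add: Fract_of_int_quotient)
  then show "u \<in> \<int>" by simp
next
  assume "u \<in> \<int>"
  then obtain n where "u = of_int n" by (elim Ints_cases)
  then show "integral_adele (adele_of_rat u)" by (simp only: integral_adele_of_int)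
qed

lemma adele_denominator:
  obtains m where "m > 0" "integral_adele (adele_of_rat (of_int m) * z)"
proof -
  obtain x m where z: "z = adele_frac x m" "m > 0" by (rule adele_frac_cases)
  then have "adele_of_rat (of_int m) * z =
      adele_of_rat (of_int m * (1 / of_int m)) * adele_of_zhat x"
    by (simp only: adele_frac_eq mult.assoc adele_of_rat_mult less_irrefl)
  also have "\<dots> = adele_of_zhat x" using z(2) by simp
  finally show thesis using that[of m] z(2) by simp
qed

text \<open>
  Every finite adele is the sum of a rational number and an integral adele. This is the
  surjectivity of the projection of the adelic group to the second coordinate.
\<close>

lemma adele_eq_rat_plus_integral:
  obtains u where "integral_adele (adele_of_rat u + z)"
proof -
  obtain x m where z: "z = adele_frac x m" "m > 0" by (rule adele_frac_cases)
  obtain n where "of_int m dvd x - of_int n"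
    using zhat_approx_int[of "nat m" x] z(2) by auto
  then obtain y where "x - of_int n = of_int m * y" by (elim dvdE)
  then have x: "x = of_int n + of_int m * y" by (metis diff_add_cancel add.commute)
  have "z = adele_of_rat (1 / of_int m) * (adele_of_rat (of_int n) +
      adele_of_rat (of_int m) * adele_of_zhat y)"
    using z(2) by (simp only: z(1) x adele_frac_eq adele_of_zhat_add adele_of_zhat_mult
        adele_of_rat_of_int less_irrefl)
  also have "\<dots> = adele_of_rat (1 / of_int m) * adele_of_rat (of_int n) +
      adele_of_rat (1 / of_int m) * adele_of_rat (of_int m) * adele_of_zhat y"
    by (simp only: distrib_left mult.assoc)
  also have "\<dots> = adele_of_rat (of_int n / of_int m) + adele_of_zhat y"
    using z(2) by (simp flip: adele_of_rat_mult)
  finally show thesis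
    using that[of "- (of_int n / of_int m)"] by (simp add: adele_of_rat_minus)
qed

text \<open>
  The adelic form of the absence of nonzero divisible elements in \<open>zhat\<close>.
\<close>

lemma adele_divisible_eq_0:
  assumes "\<And>n. n > 0 \<Longrightarrow> integral_adele (w * adele_of_rat (1 / of_int n))"
  shows "w = 0"
proof -
  obtain x where x: "w = adele_of_zhat x" using assms[of 1] by auto
  have "of_int n dvd x" if n: "n > 0" for n
  proof -
    obtain y where "w * adele_of_rat (1 / of_int n) = adele_of_zhat y" using assms[OF n] by blast
    then have "w * (adele_of_rat (1 / of_int n) * adele_of_rat (of_int n)) =
        adele_of_zhat y * adele_of_zhat (of_int n)"
      by (simp only: adele_of_rat_of_int flip: mult.assoc)
    moreover have "adele_of_rat (1 / of_int n) * adele_of_rat (of_int n) = 1"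
      using n by (simp flip: adele_of_rat_mult)
    ultimately have "adele_of_zhat x = adele_of_zhat (of_int n * y)"
      by (simp add: x adele_of_zhat_mult mult.commute)
    then have "x = of_int n * y" by (rule injD[OF inj_adele_of_zhat])
    then show ?thesis by simp
  qed
  then have "x = 0" by (rule zhat_divisible_eq_0)
  then show ?thesis by (simp add: x)
qed

text \<open>
  Clearing the denominators of a unit and of its inverse makes the numerator a divisor of a
  positive integer, so it is an integer times a unit of \<open>zhat\<close>.
\<close>

lemma adele_unit_decomposition:
  assumes "w dvd 1"
  obtains r \<epsilon> where "r \<noteq> 0" "\<epsilon> dvd 1" "w = adele_of_rat r * adele_of_zhat \<epsilon>"
proof -
  obtain w' where ww': "w * w' = 1" using assms by (metis dvdE)
  obtain x m where w: "w = adele_frac x m" "m > 0" by (rule adele_frac_cases)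
  obtain y n where w': "w' = adele_frac y n" "n > 0" by (rule adele_frac_cases)
  have "adele_frac (x * y) (m * n) = adele_frac 1 1"
    using ww' w w' by (simp add: adele_frac_mult flip: adele_of_zhat_def)
  then have "x dvd of_int (m * n)" using w(2) w'(2)
    by (simp add: adele_frac_eq_iff) (metis dvd_triv_left)
  then obtain k \<epsilon> where k: "k \<noteq> 0" "\<epsilon> dvd 1" "x = of_int k * \<epsilon>"
    using zhat_dvd_int_associate[of x "m * n"] w(2) w'(2) by auto
  then have "w = adele_of_rat (of_int k / of_int m) * adele_of_zhat \<epsilon>"
    using w by (simp add: adele_frac_eq adele_of_zhat_mult divide_inverse mult.commute
        mult.left_commute adele_of_rat_mult adele_of_rat_of_int)
  moreover have "of_int k / of_int m \<noteq> (0::rat)" using k(1) w(2) by simp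
  ultimately show thesis using that k(2) by blast
qed

section \<open>The groups attached to finite adeles\<close>

lemma mem_adelic_group:
  "(u, v) \<in> carrier (adelic_group z) \<longleftrightarrow> integral_adele (adele_of_rat u + z * adele_of_rat v)"
  by (simp add: adelic_group_def)

lemma mult_adelic_group [simp]:
  "(u, v) \<otimes>\<^bsub>adelic_group z\<^esub> (u', v') = (u + u', v + v')"
  by (simp add: adelic_group_def)

lemma one_adelic_group [simp]: "\<one>\<^bsub>adelic_group z\<^esub> = (0, 0)"
  by (simp add: adelic_group_def)

lemma adelic_group_add_closed:
  assumes "(u, v) \<in> carrier (adelic_group z)" "(u', v') \<in> carrier (adelic_group z)"
  shows "(u + u', v + v') \<in> carrier (adelic_group z)"
  using integral_adele_add[OF assms[unfolded mem_adelic_group]]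
  by (simp add: mem_adelic_group adele_of_rat_add algebra_simps)

lemma adelic_group_uminus_closed:
  assumes "(u, v) \<in> carrier (adelic_group z)"
  shows "(- u, - v) \<in> carrier (adelic_group z)"
  using integral_adele_minus[OF assms[unfolded mem_adelic_group]]
  by (simp add: mem_adelic_group adele_of_rat_minus)

lemma comm_group_adelic_group: "comm_group (adelic_group z)"
proof (rule comm_groupI)
  show "\<one>\<^bsub>adelic_group z\<^esub> \<in> carrier (adelic_group z)"
    using integral_adele_of_int[of 0] by (simp add: mem_adelic_group)
  fix x assume x: "x \<in> carrier (adelic_group z)"
  show "\<exists>y\<in>carrier (adelic_group z). y \<otimes>\<^bsub>adelic_group z\<^esub> x = \<one>\<^bsub>adelic_group z\<^esub>"
  proof (cases x)
    case (Pair u v)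
    with x show ?thesis
      by (intro bexI[of _ "(- u, - v)"]) (auto intro: adelic_group_uminus_closed)
  qed
qed (auto intro: adelic_group_add_closed)

lemma group_adelic_group: "group (adelic_group z)"
  using comm_group_adelic_group by (rule comm_group.axioms(2))

lemma int_pow_adelic_group:
  assumes "(u, v) \<in> carrier (adelic_group z)"
  shows "(u, v) [^]\<^bsub>adelic_group z\<^esub> (n::int) = (of_int n * u, of_int n * v)"
proof -
  interpret group "adelic_group z" by (rule group_adelic_group)
  have nat: "(u, v) [^]\<^bsub>adelic_group z\<^esub> (k::nat) = (of_nat k * u, of_nat k * v)" for k
    by (induction k) (auto simp: algebra_simps)
  have inv: "inv\<^bsub>adelic_group z\<^esub> (x, y) = (- x, - y)"
    if "(x, y) \<in> carrier (adelic_group z)" for x y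
    by (rule inv_equality) (use that adelic_group_uminus_closed in auto)
  have "(of_nat k * u, of_nat k * v) \<in> carrier (adelic_group z)" for k
    using nat_pow_closed[OF assms, of k] by (simp add: nat)
  then show ?thesis
    by (cases n) (simp_all only: int_pow_int int_pow_neg_int[OF assms] nat inv of_int_minus
        of_int_of_nat_eq minus_mult_left)
qed

text \<open>
  The kernel of the second projection is the copy of \<open>\<int>\<close> that the extension starts from.
\<close>

lemma adelic_group_axis:
  "(u, 0) \<in> carrier (adelic_group z) \<longleftrightarrow> u \<in> \<int>"
  by (simp add: mem_adelic_group integral_adele_of_rat_iff)

lemma adelic_group_0_1: "(0, 1) \<in> carrier (adelic_group (adele_of_zhat x))"
  by (simp add: mem_adelic_group)

section \<open>Homomorphisms and Moebius transformations\<close>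

text \<open>
  The source lies between \<open>\<int>\<^sup>2\<close> and \<open>\<rat>\<^sup>2\<close>, so a multiple of each of its elements is an integral
  combination of the two basis vectors, and the target has no torsion.
\<close>

lemma adelic_hom_matrix:
  assumes hom: "\<phi> \<in> hom (adelic_group (adele_of_zhat y)) (adelic_group (adele_of_zhat x))"
    and cols: "\<phi> (1, 0) = (a, c)" "\<phi> (0, 1) = (b, d)"
    and uv: "(u, v) \<in> carrier (adelic_group (adele_of_zhat y))"
  shows "\<phi> (u, v) = (a * u + b * v, c * u + d * v)"
proof -
  let ?A = "adelic_group (adele_of_zhat y)" and ?B = "adelic_group (adele_of_zhat x)"
  interpret A: group ?A by (rule group_adelic_group)
  have pow: "\<phi> (of_int n * s, of_int n * t) = (of_int n * fst (\<phi> (s, t)), of_int n * snd (\<phi> (s, t)))"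
    if "(s, t) \<in> carrier ?A" for n s t
  proof -
    have "\<phi> ((s, t) [^]\<^bsub>?A\<^esub> n) = \<phi> (s, t) [^]\<^bsub>?B\<^esub> n"
      by (rule hom_int_pow[OF hom that group_adelic_group group_adelic_group])
    moreover have "(fst (\<phi> (s, t)), snd (\<phi> (s, t))) \<in> carrier ?B"
      using hom_in_carrier[OF hom that] by simp
    ultimately show ?thesis using that by (metis int_pow_adelic_group prod.collapse)
  qed
  obtain k n where u: "u = of_int k / of_int n" "n > 0"
    by (metis Fract_of_int_quotient Rat_cases)
  obtain l m where v: "v = of_int l / of_int m" "m > 0"
    by (metis Fract_of_int_quotient Rat_cases)
  define i j where "i = k * m" and "j = l * n"
  have ij: "of_int (n * m) * u = of_int i" "of_int (n * m) * v = of_int j"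
    using u v by (simp_all add: i_def j_def)
  have e: "(1, 0) \<in> carrier ?A" "(0, 1) \<in> carrier ?A"
    by (simp_all add: adelic_group_axis adelic_group_0_1)
  have "\<phi> ((of_int i * 1, of_int i * 0) \<otimes>\<^bsub>?A\<^esub> (of_int j * 0, of_int j * 1)) =
    \<phi> (of_int i * 1, of_int i * 0) \<otimes>\<^bsub>?B\<^esub> \<phi> (of_int j * 0, of_int j * 1)"
    by (rule hom_mult[OF hom])
      (use e A.int_pow_closed[of "(1,0)" i] A.int_pow_closed[of "(0,1)" j] in
        \<open>simp_all add: int_pow_adelic_group\<close>)
  then have "\<phi> (of_int i, of_int j) = (of_int i * a + of_int j * b, of_int i * c + of_int j * d)"
    by (simp only: pow[OF e(1)] pow[OF e(2)]) (simp add: cols)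
  moreover have "\<phi> (of_int i, of_int j) =
      (of_int (n * m) * fst (\<phi> (u, v)), of_int (n * m) * snd (\<phi> (u, v)))"
    using pow[OF uv, of "n * m"] by (simp only: ij)
  moreover have "of_int i * r + of_int j * s = of_int (n * m) * (r * u + s * v)" for r s
    unfolding ij[symmetric] by (simp add: algebra_simps)
  ultimately have "of_int (n * m) * fst (\<phi> (u, v)) = of_int (n * m) * (a * u + b * v)"
    "of_int (n * m) * snd (\<phi> (u, v)) = of_int (n * m) * (c * u + d * v)"
    by (simp_all only: prod.inject)
  then show ?thesis using u(2) v(2) by (simp add: prod_eq_iff)
qed

text \<open>
  For every rational \<open>v\<close> there is a rational \<open>u\<close> with \<open>u + y v\<close> integral. Subtracting
  \<open>a + c x\<close> times this element from the integral element obtained from \<open>\<phi> (u, v)\<close> leaves the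
  difference of the two sides of the equation, multiplied by \<open>v\<close>. With the denominator of \<open>a + c x\<close>
  cleared, that product is integral for \<open>v = 1/n\<close> with any \<open>n\<close>, so the difference is zero.
\<close>

lemma adelic_hom_moebius:
  assumes hom: "\<phi> \<in> hom (adelic_group (adele_of_zhat y)) (adelic_group (adele_of_zhat x))"
    and cols: "\<phi> (1, 0) = (a, c)" "\<phi> (0, 1) = (b, d)"
  shows "adele_of_rat b + adele_of_rat d * adele_of_zhat x =
    (adele_of_rat a + adele_of_rat c * adele_of_zhat x) * adele_of_zhat y"
proof -
  define w where "w = adele_of_rat a + adele_of_rat c * adele_of_zhat x"
  define D where "D = adele_of_rat b + adele_of_rat d * adele_of_zhat x - w * adele_of_zhat y"
  obtain m where m: "m > 0" "integral_adele (adele_of_rat (of_int m) * w)"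
    by (rule adele_denominator)
  have "adele_of_rat (of_int m) * D = 0"
  proof (rule adele_divisible_eq_0)
    fix n :: int assume "n > 0"
    define v where "v = 1 / rat_of_int n"
    obtain u where u: "integral_adele (adele_of_rat u + adele_of_zhat y * adele_of_rat v)"
      by (rule adele_eq_rat_plus_integral)
    then have uv: "(u, v) \<in> carrier (adelic_group (adele_of_zhat y))"
      by (simp add: mem_adelic_group)
    have "(a * u + b * v, c * u + d * v) \<in> carrier (adelic_group (adele_of_zhat x))"
      using hom_in_carrier[OF hom uv] by (simp add: adelic_hom_matrix[OF hom cols uv])
    then have int: "integral_adele
      (adele_of_rat (a * u + b * v) + adele_of_zhat x * adele_of_rat (c * u + d * v))"
      by (simp add: mem_adelic_group)
    have "adele_of_rat (of_int m) * D * adele_of_rat v =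
        adele_of_rat (of_int m) *
          (adele_of_rat (a * u + b * v) + adele_of_zhat x * adele_of_rat (c * u + d * v)) -
        (adele_of_rat (of_int m) * w) * (adele_of_rat u + adele_of_zhat y * adele_of_rat v)"
      by (simp add: D_def w_def adele_of_rat_add adele_of_rat_mult algebra_simps)
    then show "integral_adele (adele_of_rat (of_int m) * D * adele_of_rat (1 / of_int n))"
      unfolding v_def[symmetric]
      using u int m(2) by (simp only: integral_adele_diff integral_adele_mult integral_adele_of_int)
  qed
  moreover have "adele_of_rat (1 / of_int m) * adele_of_rat (of_int m) = 1"
    using m(1) by (simp flip: adele_of_rat_mult)
  ultimately have "D = 0" by (metis mult.assoc mult_1 mult_zero_right)
  then show ?thesis by (simp add: D_def w_def)
qed

text \<open>
  Since \<open>(a u + b v) + z (c u + d v) = (a + c z) (u + z' v)\<close>, only the unit \<open>a + c z\<close> separates the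
  two integrality conditions. Its rational part \<open>r\<close> is divided out of the matrix, and the
  remaining unit of \<open>zhat\<close> preserves integrality in both directions.
\<close>

lemma adelic_group_iso_moebius:
  assumes det: "a * d - b * c \<noteq> 0"
    and unit: "(adele_of_rat a + adele_of_rat c * z) dvd 1"
    and z': "adele_of_rat b + adele_of_rat d * z = z' * (adele_of_rat a + adele_of_rat c * z)"
  shows "adelic_group z' \<cong> adelic_group z"
proof -
  obtain r \<epsilon> where r: "r \<noteq> 0" and \<epsilon>: "\<epsilon> dvd 1"
    and w: "adele_of_rat a + adele_of_rat c * z = adele_of_rat r * adele_of_zhat \<epsilon>"
    by (rule adele_unit_decomposition[OF unit])
  obtain \<delta> where "\<epsilon> * \<delta> = 1" using \<epsilon> by (metis dvdE)
  then have \<delta>: "adele_of_zhat \<delta> * adele_of_zhat \<epsilon> = 1"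
    by (simp add: mult.commute flip: adele_of_zhat_mult)
  have unit_int: "integral_adele (adele_of_zhat \<epsilon> * t) \<longleftrightarrow> integral_adele t" for t
    using integral_adele_mult[of "adele_of_zhat \<epsilon>" t]
      integral_adele_mult[of "adele_of_zhat \<delta>" "adele_of_zhat \<epsilon> * t"] \<delta>
    by (auto simp flip: mult.assoc)
  define f where "f = (\<lambda>(u, v). ((a * u + b * v) / r, (c * u + d * v) / r))"
  define g where "g = (\<lambda>(u, v). (r * (d * u - b * v) / (a * d - b * c),
    r * (a * v - c * u) / (a * d - b * c)))"
  have gf: "g (f t) = t" and fg: "f (g t) = t" for t
    using r det by (cases t; simp add: f_def g_def divide_simps; simp add: algebra_simps)+
  have f: "f t \<in> carrier (adelic_group z) \<longleftrightarrow> t \<in> carrier (adelic_group z')" for t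
  proof -
    obtain u v where t: "t = (u, v)" by (cases t)
    define R where "R = adele_of_rat (1 / r)"
    have R: "R * adele_of_rat r = 1" using r by (simp add: R_def flip: adele_of_rat_mult)
    have R_div: "adele_of_rat (s / r) = R * adele_of_rat s" for s
      by (simp add: R_def flip: adele_of_rat_mult)
    have "adele_of_rat ((a * u + b * v) / r) + z * adele_of_rat ((c * u + d * v) / r) =
      R * ((adele_of_rat a + adele_of_rat c * z) * adele_of_rat u +
        (adele_of_rat b + adele_of_rat d * z) * adele_of_rat v)"
      by (simp add: R_div adele_of_rat_add adele_of_rat_mult algebra_simps)
    also have "\<dots> = (R * adele_of_rat r) *
      (adele_of_zhat \<epsilon> * (adele_of_rat u + z' * adele_of_rat v))"
      unfolding z' w by (simp add: algebra_simps)
    finally show ?thesis by (simp add: t f_def mem_adelic_group R unit_int)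
  qed
  have "f \<in> iso (adelic_group z') (adelic_group z)"
  proof (rule isoI)
    show "f \<in> hom (adelic_group z') (adelic_group z)"
    proof (rule homI)
      show "f (s \<otimes>\<^bsub>adelic_group z'\<^esub> t) = f s \<otimes>\<^bsub>adelic_group z\<^esub> f t" for s t
        by (cases s; cases t) (simp add: f_def algebra_simps add_divide_distrib)
    qed (simp add: f)
    show "bij_betw f (carrier (adelic_group z')) (carrier (adelic_group z))"
      by (rule bij_betw_byWitness[of _ g]) (auto simp: f gf fg simp flip: f[of "g _"])
  qed
  then show ?thesis by (auto simp: is_iso_def)
qed

lemma moebius_eq_SomeD:
  assumes "moebius z g = Some z'"
  obtains a b c d where "a * d - b * c \<noteq> 0" "(adele_of_rat a + adele_of_rat c * z) dvd 1"
    "adele_of_rat b + adele_of_rat d * z = z' * (adele_of_rat a + adele_of_rat c * z)"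
proof -
  define M where "M = rep_pgl2_rat g"
  have M: "pgl2_rel M M" "abs_pgl2_rat M = g"
    unfolding M_def
    using Quotient3_rep_reflp[OF Quotient3_pgl2_rat] Quotient3_abs_rep[OF Quotient3_pgl2_rat]
    by auto
  have "det M \<noteq> 0" using M(1) by (simp add: pgl2_rel_def invertible_det_nz)
  then have det: "M $ 1 $ 1 * M $ 2 $ 2 - M $ 1 $ 2 * M $ 2 $ 1 \<noteq> 0" by (simp add: det_2)
  let ?w = "adele_of_rat (M $ 1 $ 1) + adele_of_rat (M $ 2 $ 1) * z"
  let ?s = "adele_of_rat (M $ 1 $ 2) + adele_of_rat (M $ 2 $ 2) * z"
  have w: "?w dvd 1" and z': "z' = ?s / ?w"
    using assms unfolding M(2)[symmetric] moebius.abs_eq[OF M(1)]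
    by (auto simp: Let_def split: if_splits)
  show thesis
    using det w by (rule that) (simp only: z' adele_divide_mult[OF w])
qed

lemma moebius_eq_SomeI:
  fixes a b c d :: rat
  assumes "a * d - b * c \<noteq> 0" and unit: "(adele_of_rat a + adele_of_rat c * z) dvd 1"
    and "adele_of_rat b + adele_of_rat d * z = (adele_of_rat a + adele_of_rat c * z) * z'"
  shows "\<exists>g. moebius z g = Some z'"
proof -
  define M :: "rat^2^2" where "M = vector [vector [a, b], vector [c, d]]"
  have M: "M $ 1 $ 1 = a" "M $ 1 $ 2 = b" "M $ 2 $ 1 = c" "M $ 2 $ 2 = d"
    by (simp_all add: M_def)
  have "invertible M" using assms(1) by (simp add: invertible_det_nz det_2 M)
  then have "pgl2_rel M M"
    unfolding pgl2_rel_def by (metis matrix_mul_lid zero_neq_one)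
  moreover have "(adele_of_rat b + adele_of_rat d * z) / (adele_of_rat a + adele_of_rat c * z) = z'"
    by (rule adele_divide_eqI[OF unit]) (simp only: assms(3) mult.commute[of z'])
  ultimately have "moebius z (abs_pgl2_rat M) = Some z'"
    using unit by (simp add: moebius.abs_eq M Let_def)
  then show ?thesis ..
qed

text \<open>
  Two representatives of a class differ by a rational translation, which is the Moebius
  transformation of a unipotent matrix.
\<close>

lemma adelic_group_iso_same_class:
  assumes "adele_class z = adele_class w"
  shows "adelic_group z \<cong> adelic_group w"
proof -
  obtain q where "w - z = adele_of_rat q" using assms by (auto simp: adele_class.abs_eq_iff)
  then have "z = adele_of_rat (- q) + w" by (simp add: adele_of_rat_minus algebra_simps)
  then show ?thesis
    by (intro adelic_group_iso_moebius[of 1 1 "- q" 0]) (simp_all add: algebra_simps)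
qed

text \<open>
  The matrices of an isomorphism and of its inverse are inverse to each other, and
  \<open>(a + c x) (a' + c' y) = (a a' + b c') + (c a' + d c') x = 1\<close> shows that the denominator of the
  Moebius transformation is a unit.
\<close>

lemma adelic_group_iso_imp_moebius:
  assumes "adelic_group (adele_of_zhat y) \<cong> adelic_group (adele_of_zhat x)"
  shows "\<exists>g. moebius (adele_of_zhat x) g = Some (adele_of_zhat y)"
proof -
  let ?X = "adelic_group (adele_of_zhat x)" and ?Y = "adelic_group (adele_of_zhat y)"
  interpret Y: group ?Y by (rule group_adelic_group)
  obtain \<phi> where iso: "\<phi> \<in> iso ?Y ?X" using assms by (auto simp: is_iso_def)
  define \<psi> where "\<psi> = inv_into (carrier ?Y) \<phi>"
  have \<phi>: "\<phi> \<in> hom ?Y ?X" and \<psi>: "\<psi> \<in> hom ?X ?Y"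
    unfolding \<psi>_def using iso Y.iso_set_sym by (blast intro: iso_imp_homomorphism)+
  have bij: "bij_betw \<phi> (carrier ?Y) (carrier ?X)" using iso by (simp add: iso_def)
  have \<phi>\<psi>: "\<phi> (\<psi> t) = t" if "t \<in> carrier ?X" for t
    using bij that unfolding \<psi>_def by (rule bij_betw_inv_into_right)
  have axes: "(1, 0) \<in> carrier (adelic_group z)" for z by (simp add: adelic_group_axis)
  obtain a c b d where cols: "\<phi> (1, 0) = (a, c)" "\<phi> (0, 1) = (b, d)" by (metis surj_pair)
  obtain a' c' b' d' where cols': "\<psi> (1, 0) = (a', c')" "\<psi> (0, 1) = (b', d')"
    by (metis surj_pair)
  have "(a', c') \<in> carrier ?Y" "(b', d') \<in> carrier ?Y"
    using hom_in_carrier[OF \<psi> axes] hom_in_carrier[OF \<psi> adelic_group_0_1] cols' by simp_all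
  then have "(a * a' + b * c', c * a' + d * c') = (1, 0)" "(a * b' + b * d', c * b' + d * d') = (0, 1)"
    using \<phi>\<psi>[OF axes] \<phi>\<psi>[OF adelic_group_0_1] cols' adelic_hom_matrix[OF \<phi> cols] by simp_all
  then have inv: "a * a' + b * c' = 1" "c * a' + d * c' = 0" "a * b' + b * d' = 0" "c * b' + d * d' = 1"
    by simp_all
  define w where "w = adele_of_rat a + adele_of_rat c * adele_of_zhat x"
  have s: "adele_of_rat b + adele_of_rat d * adele_of_zhat x = w * adele_of_zhat y"
    unfolding w_def by (rule adelic_hom_moebius[OF \<phi> cols])
  have "(a * d - b * c) * (a' * d' - b' * c') =
      (a * a' + b * c') * (c * b' + d * d') - (a * b' + b * d') * (c * a' + d * c')"
    by (simp add: algebra_simps)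
  then have det: "a * d - b * c \<noteq> 0" by (auto simp: inv)
  have "w * (adele_of_rat a' + adele_of_rat c' * adele_of_zhat y) =
      w * adele_of_rat a' + (w * adele_of_zhat y) * adele_of_rat c'"
    by (simp add: algebra_simps)
  also have "\<dots> = adele_of_rat (a * a' + b * c') + adele_of_rat (c * a' + d * c') * adele_of_zhat x"
    unfolding s[symmetric]
    by (simp add: w_def adele_of_rat_add adele_of_rat_mult algebra_simps)
  also have "\<dots> = 1" by (simp add: inv)
  finally have "w dvd 1" by (metis dvd_triv_left)
  then show ?thesis using moebius_eq_SomeI[OF det, of "adele_of_zhat x"] s by (simp add: w_def)
qed

section \<open>The class of an extension\<close>

text \<open>
  Pick elements of \<open>G\<close> over the fractions \<open>1/n\<close>. Their first coordinates are \<open>- c n / n\<close> with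
  integers \<open>c n\<close> that are compatible under divisibility, because \<open>G\<close> meets the first axis in \<open>\<int>\<close>; the
  limit \<open>x\<close> of \<open>c n\<close> satisfies \<open>- c n / n + x / n \<in> zhat\<close>. So \<open>G\<close> is contained in the adelic group of
  \<open>x\<close>. Both have the same projection and the same intersection with the first axis, hence agree.
\<close>

lemma rat_plane_subgroup_eq_adelic_group:
  fixes G :: "(rat \<times> rat) set"
  assumes diff: "\<And>u v u' v'. (u, v) \<in> G \<Longrightarrow> (u', v') \<in> G \<Longrightarrow> (u - u', v - v') \<in> G"
    and axis: "\<And>u. (u, 0) \<in> G \<longleftrightarrow> u \<in> \<int>"
    and proj: "\<And>v. \<exists>u. (u, v) \<in> G"
    and sect: "(0, 1) \<in> G"
  obtains x where "G = carrier (adelic_group (adele_of_zhat x))"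
proof -
  have zero: "(0, 0) \<in> G" by (simp add: axis)
  have mult: "(of_int k * u, of_int k * v) \<in> G" if uv: "(u, v) \<in> G" for k u v
  proof (induction k rule: int_induct[of _ 0])
    case (step1 k)
    show ?case using diff[OF step1(2) diff[OF zero uv]] by (simp add: algebra_simps)
  next
    case (step2 k)
    show ?case using diff[OF step2(2) uv] by (simp add: algebra_simps)
  qed (simp add: zero)
  have "\<exists>c. (- (of_int c / of_int n), 1 / of_int n) \<in> G" if n: "n > 0" for n :: int
  proof -
    obtain u where u: "(u, 1 / of_int n) \<in> G" using proj by blast
    have "(of_int n * u - 0, of_int n * (1 / of_int n) - 1) \<in> G"
      by (rule diff[OF mult[OF u] sect])
    then have "of_int n * u \<in> \<int>" using n by (simp add: axis)
    then obtain c where "of_int n * u = of_int c" by (elim Ints_cases)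
    then have "u = - (of_int (- c) / of_int n)" using n by (simp add: field_simps)
    then show ?thesis using u by metis
  qed
  then obtain c :: "int \<Rightarrow> int" where
    c: "\<And>n. n > 0 \<Longrightarrow> (- (of_int (c n) / of_int n), 1 / of_int n) \<in> G"
    by metis
  have compat: "[c n = c m] (mod m)" if mn: "0 < m" "0 < n" "m dvd n" for m n
  proof -
    obtain r where r: "n = m * r" using mn(3) by (elim dvdE)
    then have r0: "r \<noteq> 0" using mn by auto
    have "(of_int r * (- (of_int (c n) / of_int n)) - (- (of_int (c m) / of_int m)),
        of_int r * (1 / of_int n) - 1 / of_int m) \<in> G"
      using mn by (intro diff mult c)
    then have "(of_int (c m) - of_int (c n)) / of_int m \<in> (\<int> :: rat set)"
      using mn r r0 by (simp add: axis diff_divide_distrib)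
    then obtain k where "(of_int (c m) - of_int (c n)) / of_int m = (of_int k :: rat)"
      by (elim Ints_cases)
    then have "of_int (c m - c n) = (of_int (m * k) :: rat)" using mn(1) by (simp add: field_simps)
    then have "c m - c n = m * k" by (simp only: of_int_eq_iff)
    then show ?thesis by (metis cong_iff_dvd_diff cong_sym dvd_triv_left)
  qed
  obtain x :: zhat where x: "\<forall>n>0. of_int n dvd x - of_int (c n)"
    using zhat_of_compatible_residues[of c, OF compat] ..
  let ?A = "adelic_group (adele_of_zhat x)"
  have c_adelic: "(- (of_int (c n) / of_int n), 1 / of_int n) \<in> carrier ?A" if n: "n > 0" for n
  proof -
    obtain y where "x - of_int (c n) = of_int n * y" using x n by (blast elim: dvdE)
    then have "x = of_int (c n) + of_int n * y" by (metis diff_add_cancel add.commute)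
    then have "adele_of_rat (- (of_int (c n) / of_int n)) + adele_of_zhat x * adele_of_rat (1 / of_int n) =
      - (adele_of_rat (1 / of_int n) * adele_of_rat (of_int (c n))) +
        adele_of_rat (1 / of_int n) * adele_of_rat (of_int (c n)) +
        (adele_of_rat (1 / of_int n) * adele_of_rat (of_int n)) * adele_of_zhat y"
      by (simp add: adele_of_zhat_add adele_of_zhat_mult adele_of_rat_of_int adele_of_rat_minus
          adele_of_rat_mult divide_inverse algebra_simps)
    also have "\<dots> = adele_of_zhat y" using n by (simp flip: adele_of_rat_mult)
    finally show ?thesis by (simp add: mem_adelic_group)
  qed
  have sub: "(u, v) \<in> carrier ?A" if uv: "(u, v) \<in> G" for u v
  proof -
    obtain k n where v: "v = of_int k / of_int n" "n > 0"
      by (metis Fract_of_int_quotient Rat_cases)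
    define u' :: rat where "u' = of_int k * (- (of_int (c n) / of_int n))"
    have v': "v = of_int k * (1 / of_int n)" using v by simp
    have "(u', v) \<in> G" unfolding u'_def v' using v(2) by (intro mult c)
    then have "(u - u', 0) \<in> G" using diff[OF uv, of u' v] by simp
    then have "(u - u', 0) \<in> carrier ?A" by (simp add: axis adelic_group_axis)
    moreover have "(u', v) \<in> carrier ?A"
      using group.int_pow_closed[OF group_adelic_group c_adelic[OF v(2)], of k]
      by (simp only: int_pow_adelic_group[OF c_adelic[OF v(2)]] u'_def v')
    ultimately show ?thesis using adelic_group_add_closed by fastforce
  qed
  have "(u, v) \<in> G" if uv: "(u, v) \<in> carrier ?A" for u v
  proof -
    obtain u' where u': "(u', v) \<in> G" using proj by blast
    have "(u - u', 0) \<in> carrier ?A"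
      using adelic_group_add_closed[OF uv adelic_group_uminus_closed[OF sub[OF u']]] by simp
    then have "(u - u', 0) \<in> G" by (simp add: axis adelic_group_axis)
    then show ?thesis using diff[OF _ diff[OF zero u']] by fastforce
  qed
  then have "G = carrier ?A" using sub by auto
  then show thesis by (rule that)
qed

lemma group_rat_group: "group rat_group"
  by (rule groupI) (auto simp: rat_group_def intro: exI[of _ "- _"])

lemma int_pow_rat_group: "q [^]\<^bsub>rat_group\<^esub> (n::int) = of_int n * q"
proof -
  have nat: "q [^]\<^bsub>rat_group\<^esub> (k::nat) = of_nat k * q" for k
    by (induction k) (auto simp: rat_group_def algebra_simps)
  have inv: "inv\<^bsub>rat_group\<^esub> r = - r" for r
    by (rule group.inv_equality[OF group_rat_group]) (auto simp: rat_group_def)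
  show ?thesis by (simp add: int_pow_def2 nat inv)
qed

text \<open>
  A lift \<open>e\<close> of 1 gives coordinates: a power of each \<open>a\<close> lies in the subgroup generated by \<open>e\<close> and
  the image of \<open>\<int>\<close>. The resulting embedding into \<open>\<rat>\<^sup>2\<close> has \<open>p\<close> as second coordinate, and its image
  meets the hypotheses of \<open>rat_plane_subgroup_eq_adelic_group\<close>.
\<close>

lemma rat_extension_equivalent_adelic_group:
  fixes A :: "'a monoid"
  assumes ext: "rat_extension A i p"
  obtains x where
    "equivalent_extensions A i p (adelic_group (adele_of_zhat x)) adelic_incl adelic_proj"
proof -
  interpret comm_group A using ext by (simp add: rat_extension_def)
  have i_hom: "i \<in> hom integer_group A" and inj: "inj i"
    and p_hom: "p \<in> hom A rat_group" and p_surj: "p ` carrier A = UNIV"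
    and ker: "kernel A rat_group p = range i"
    using ext by (auto simp: rat_extension_def mon_def epi_def rat_group_def)
  have i_closed [simp]: "i n \<in> carrier A" for n using hom_in_carrier[OF i_hom] by simp
  have i_add: "i (m + n) = i m \<otimes>\<^bsub>A\<^esub> i n" for m n using hom_mult[OF i_hom] by simp
  have i_0: "i 0 = \<one>\<^bsub>A\<^esub>" using hom_one[OF i_hom] by simp
  have i_pow: "i m [^]\<^bsub>A\<^esub> k = i (k * m)" for m and k :: int
    using hom_int_pow[OF i_hom, of m k] by simp
  have p_add: "p (a \<otimes>\<^bsub>A\<^esub> b) = p a + p b" if "a \<in> carrier A" "b \<in> carrier A" for a b
    using hom_mult[OF p_hom that] by (simp add: rat_group_def)
  have p_pow: "p (a [^]\<^bsub>A\<^esub> k) = of_int k * p a" if "a \<in> carrier A" for a and k :: int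
    using hom_int_pow[OF p_hom that is_group group_rat_group] by (simp add: int_pow_rat_group)
  have p_i: "p (i n) = 0" for n
    using ker by (auto simp: kernel_def rat_group_def)
  have p_eq_0: "\<exists>n. a = i n" if "a \<in> carrier A" "p a = 0" for a
    using that ker by (auto simp: kernel_def rat_group_def)
  obtain e where e [simp]: "e \<in> carrier A" and p_e: "p e = 1"
    using p_surj by (metis UNIV_I imageE)
  \<comment> \<open>\<open>D a N m\<close>: the first coordinate of \<open>a\<close> is the fraction \<open>m / N\<close>.\<close>
  define D where "D a N m \<longleftrightarrow> (\<exists>l::int. a [^]\<^bsub>A\<^esub> N = i m \<otimes>\<^bsub>A\<^esub> e [^]\<^bsub>A\<^esub> l)" for a m and N :: int
  have D_ex: "\<exists>N m. N > 0 \<and> D a N m" if a: "a \<in> carrier A" for a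
  proof -
    obtain l N where l: "p a = of_int l / of_int N" "N > 0"
      by (metis Fract_of_int_quotient Rat_cases)
    have "p (a [^]\<^bsub>A\<^esub> N \<otimes>\<^bsub>A\<^esub> e [^]\<^bsub>A\<^esub> (- l)) = 0"
      using a l by (simp add: p_add p_pow p_e)
    then obtain m where "a [^]\<^bsub>A\<^esub> N \<otimes>\<^bsub>A\<^esub> e [^]\<^bsub>A\<^esub> (- l) = i m" using p_eq_0 a by force
    then have "a [^]\<^bsub>A\<^esub> N = i m \<otimes>\<^bsub>A\<^esub> e [^]\<^bsub>A\<^esub> l"
      using a by (metis e i_closed int_pow_closed int_pow_neg inv_solve_right)
    then show ?thesis using l(2) by (auto simp: D_def)
  qed
  have D_unique: "m = m'" if D: "D a N m" "D a N m'" for a N m m'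
  proof -
    obtain l :: int where "a [^]\<^bsub>A\<^esub> N = i m \<otimes>\<^bsub>A\<^esub> e [^]\<^bsub>A\<^esub> l"
      using D(1) unfolding D_def ..
    moreover obtain l' :: int where "a [^]\<^bsub>A\<^esub> N = i m' \<otimes>\<^bsub>A\<^esub> e [^]\<^bsub>A\<^esub> l'"
      using D(2) unfolding D_def ..
    ultimately have l: "i m \<otimes>\<^bsub>A\<^esub> e [^]\<^bsub>A\<^esub> l = i m' \<otimes>\<^bsub>A\<^esub> e [^]\<^bsub>A\<^esub> l'" by simp
    then have "p (i m \<otimes>\<^bsub>A\<^esub> e [^]\<^bsub>A\<^esub> l) = p (i m' \<otimes>\<^bsub>A\<^esub> e [^]\<^bsub>A\<^esub> l')" by simp
    then have "l = l'" by (simp add: p_add p_pow p_i p_e)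
    then have "i m = i m'" using l by simp
    then show ?thesis using inj by (rule injD[rotated])
  qed
  have D_scale: "D a (k * N) (k * m)" if D: "D a N m" and a: "a \<in> carrier A" for a k N m
  proof -
    obtain l where l: "a [^]\<^bsub>A\<^esub> N = i m \<otimes>\<^bsub>A\<^esub> e [^]\<^bsub>A\<^esub> (l::int)"
      using D unfolding D_def ..
    have "a [^]\<^bsub>A\<^esub> (k * N) = (a [^]\<^bsub>A\<^esub> N) [^]\<^bsub>A\<^esub> k"
      using a by (simp add: int_pow_pow mult.commute)
    also have "\<dots> = i (k * m) \<otimes>\<^bsub>A\<^esub> e [^]\<^bsub>A\<^esub> (l * k)"
      by (simp add: l int_pow_distrib i_pow int_pow_pow)
    finally show ?thesis unfolding D_def by blast
  qed
  have D_add: "D (a \<otimes>\<^bsub>A\<^esub> b) N (m + m')"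
    if D: "D a N m" "D b N m'" and ab: "a \<in> carrier A" "b \<in> carrier A" for a b N m m'
  proof -
    obtain l :: int where "a [^]\<^bsub>A\<^esub> N = i m \<otimes>\<^bsub>A\<^esub> e [^]\<^bsub>A\<^esub> l"
      using D(1) unfolding D_def ..
    moreover obtain l' :: int where "b [^]\<^bsub>A\<^esub> N = i m' \<otimes>\<^bsub>A\<^esub> e [^]\<^bsub>A\<^esub> l'"
      using D(2) unfolding D_def ..
    ultimately have "(a \<otimes>\<^bsub>A\<^esub> b) [^]\<^bsub>A\<^esub> N = i (m + m') \<otimes>\<^bsub>A\<^esub> e [^]\<^bsub>A\<^esub> (l + l')"
      using ab by (simp add: int_pow_distrib i_add int_pow_mult[symmetric] m_ac add.commute)
    then show ?thesis unfolding D_def by blast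
  qed
  define U :: "'a \<Rightarrow> rat" where
    "U a = (SOME u. \<exists>N m. N > 0 \<and> D a N m \<and> u = of_int m / of_int N)" for a
  have U_eq: "U a = of_int m / of_int N" if a: "a \<in> carrier A" and D: "D a N m" "N > 0" for a N m
  proof -
    have "\<exists>N m. N > 0 \<and> D a N m \<and> U a = of_int m / of_int N"
      unfolding U_def by (rule someI_ex) (use D in blast)
    then obtain N' m' where D': "N' > 0" "D a N' m'" "U a = of_int m' / of_int N'" by blast
    have "N * m' = N' * m"
      using D_scale[OF D'(2) a, of N] D_scale[OF D(1) a, of N']
      by (intro D_unique) (simp_all add: mult.commute)
    then have "of_int N * of_int m' = (of_int N' * of_int m :: rat)"
      by (metis of_int_mult)
    then show ?thesis using D(2) D'(1) by (simp add: D'(3) frac_eq_eq mult.commute)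
  qed
  have U_add: "U (a \<otimes>\<^bsub>A\<^esub> b) = U a + U b" if ab: "a \<in> carrier A" "b \<in> carrier A" for a b
  proof -
    obtain N m N' m' where D: "N > 0" "D a N m" "N' > 0" "D b N' m'"
      using D_ex ab by meson
    have "D a (N' * N) (N' * m)" "D b (N' * N) (N * m')"
      using D_scale[OF D(2) ab(1), of N'] D_scale[OF D(4) ab(2), of N]
      by (simp_all add: mult.commute)
    then have "D (a \<otimes>\<^bsub>A\<^esub> b) (N' * N) (N' * m + N * m')" using ab by (rule D_add)
    then have "U (a \<otimes>\<^bsub>A\<^esub> b) = of_int (N' * m + N * m') / of_int (N' * N)"
      using ab D by (intro U_eq) auto
    also have "\<dots> = U a + U b"
      using ab D by (simp add: U_eq field_simps)
    finally show ?thesis .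
  qed
  have U_i: "U (i n) = of_int n" for n
  proof -
    have "D (i n) 1 n" unfolding D_def by (rule exI[of _ 0]) simp
    then show ?thesis using U_eq[of "i n" 1 n] by simp
  qed
  have U_e: "U e = 0"
  proof -
    have "D e 1 0" unfolding D_def by (rule exI[of _ 1]) (simp add: i_0)
    then show ?thesis using U_eq[of e 1 0] by simp
  qed
  have U_diff: "U (a \<otimes>\<^bsub>A\<^esub> inv\<^bsub>A\<^esub> b) = U a - U b" "p (a \<otimes>\<^bsub>A\<^esub> inv\<^bsub>A\<^esub> b) = p a - p b"
    if "a \<in> carrier A" "b \<in> carrier A" for a b
    using U_add[of "a \<otimes>\<^bsub>A\<^esub> inv\<^bsub>A\<^esub> b" b] p_add[of "a \<otimes>\<^bsub>A\<^esub> inv\<^bsub>A\<^esub> b" b] that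
    by (simp_all add: m_assoc)
  define \<phi> where "\<phi> a = (U a, p a)" for a
  obtain x where x: "\<phi> ` carrier A = carrier (adelic_group (adele_of_zhat x))"
  proof (rule rat_plane_subgroup_eq_adelic_group)
    show "(u - u', v - v') \<in> \<phi> ` carrier A"
      if uv: "(u, v) \<in> \<phi> ` carrier A" "(u', v') \<in> \<phi> ` carrier A" for u v u' v'
    proof -
      obtain a b where "a \<in> carrier A" "(u, v) = \<phi> a" "b \<in> carrier A" "(u', v') = \<phi> b"
        using uv by blast
      then show ?thesis
        by (intro image_eqI[of _ _ "a \<otimes>\<^bsub>A\<^esub> inv\<^bsub>A\<^esub> b"]) (simp_all add: \<phi>_def U_diff)
    qed
    show "(u, 0) \<in> \<phi> ` carrier A \<longleftrightarrow> u \<in> \<int>" for u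
    proof
      assume "(u, 0) \<in> \<phi> ` carrier A"
      then obtain a where "a \<in> carrier A" "u = U a" "p a = 0" by (auto simp: \<phi>_def)
      then show "u \<in> \<int>" using p_eq_0 U_i by fastforce
    next
      assume "u \<in> \<int>"
      then obtain n where "u = of_int n" by (elim Ints_cases)
      then show "(u, 0) \<in> \<phi> ` carrier A"
        by (intro image_eqI[of _ _ "i n"]) (simp_all add: \<phi>_def U_i p_i)
    qed
    show "\<exists>u. (u, v) \<in> \<phi> ` carrier A" for v
    proof -
      obtain a where "a \<in> carrier A" "p a = v" using p_surj by (metis UNIV_I imageE)
      then have "(U a, v) \<in> \<phi> ` carrier A" by (intro image_eqI[of _ _ a]) (simp_all add: \<phi>_def)
      then show ?thesis ..
    qed
    show "(0, 1) \<in> \<phi> ` carrier A"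
      by (rule image_eqI[of _ _ e]) (simp_all add: \<phi>_def U_e p_e)
  qed
  have "inj_on \<phi> (carrier A)"
  proof (rule inj_onI)
    fix a b assume ab: "a \<in> carrier A" "b \<in> carrier A" "\<phi> a = \<phi> b"
    then have "U (a \<otimes>\<^bsub>A\<^esub> inv\<^bsub>A\<^esub> b) = 0" "p (a \<otimes>\<^bsub>A\<^esub> inv\<^bsub>A\<^esub> b) = 0"
      by (simp_all add: \<phi>_def U_diff)
    moreover from this obtain n where n: "a \<otimes>\<^bsub>A\<^esub> inv\<^bsub>A\<^esub> b = i n" using p_eq_0 ab by force
    ultimately have "n = 0" by (simp add: U_i)
    then have "a \<otimes>\<^bsub>A\<^esub> inv\<^bsub>A\<^esub> b = \<one>\<^bsub>A\<^esub>" using n by (simp add: i_0)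
    then show "a = b" using ab inv_solve_right'[of "\<one>\<^bsub>A\<^esub>" a b] by simp
  qed
  then have "\<phi> \<in> iso A (adelic_group (adele_of_zhat x))"
    using x by (auto simp: bij_betw_def \<phi>_def U_add p_add intro!: isoI homI)
  then show thesis
    by (intro that) (auto simp: equivalent_extensions_def adelic_incl_def adelic_proj_def \<phi>_def
        U_i p_i intro!: bexI[of _ \<phi>])
qed

text \<open>
  An equivalence of two such extensions fixes \<open>(1, 0)\<close> and sends \<open>(0, 1)\<close> to some \<open>(b, 1)\<close>, so the
  Moebius relation reduces to \<open>b + y = x\<close>.
\<close>

lemma equivalent_adelic_groups_same_class:
  assumes x: "equivalent_extensions A i p (adelic_group (adele_of_zhat x)) adelic_incl adelic_proj"
    and y: "equivalent_extensions A i p (adelic_group (adele_of_zhat y)) adelic_incl adelic_proj"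
    and A: "rat_extension A i p"
  shows "adele_class (adele_of_zhat x) = adele_class (adele_of_zhat y)"
proof -
  interpret comm_group A using A by (simp add: rat_extension_def)
  let ?X = "adelic_group (adele_of_zhat x)" and ?Y = "adelic_group (adele_of_zhat y)"
  have i: "i n \<in> carrier A" for n
    using A by (auto simp: rat_extension_def mon_def hom_def)
  obtain f where f: "f \<in> iso A ?X" "\<And>n. f (i n) = adelic_incl n"
    "\<And>a. a \<in> carrier A \<Longrightarrow> snd (f a) = p a"
    using x by (auto simp: equivalent_extensions_def adelic_proj_def)
  obtain g where g: "g \<in> iso A ?Y" "\<And>n. g (i n) = adelic_incl n"
    "\<And>a. a \<in> carrier A \<Longrightarrow> snd (g a) = p a"
    using y by (auto simp: equivalent_extensions_def adelic_proj_def)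
  define h where "h = g \<circ> inv_into (carrier A) f"
  have hom: "h \<in> hom ?X ?Y"
    unfolding h_def by (intro iso_imp_homomorphism iso_set_trans[OF iso_set_sym] f g)
  have inj: "inj_on f (carrier A)" and im: "f ` carrier A = carrier ?X"
    using f(1) by (auto simp: iso_iff)
  have h: "h (f a) = g a" if "a \<in> carrier A" for a
    using that inj by (simp add: h_def inv_into_f_f)
  have "h (1, 0) = (1, 0)" using h[OF i[of 1]] by (simp add: f(2) g(2) adelic_incl_def)
  moreover obtain b where "h (0, 1) = (b, 1)"
  proof -
    obtain a where "a \<in> carrier A" "f a = (0, 1)"
      using adelic_group_0_1[of x] im by (metis imageE)
    then have "snd (h (0, 1)) = 1" using h f(3) g(3) by (metis snd_conv)
    then show thesis using that by (metis prod.collapse)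
  qed
  ultimately have "adele_of_rat b + adele_of_rat 1 * adele_of_zhat y =
      (adele_of_rat 1 + adele_of_rat 0 * adele_of_zhat y) * adele_of_zhat x"
    by (rule adelic_hom_moebius[OF hom])
  then have "adele_of_zhat x - adele_of_zhat y = adele_of_rat b" by (simp add: algebra_simps)
  then have "adele_class (adele_of_zhat y) = adele_class (adele_of_zhat x)"
    by (subst adele_class.abs_eq_iff) blast
  then show ?thesis ..
qed

text \<open>
  Existence and uniqueness of the class make the definite description in \<open>ext_class\<close> meaningful.
\<close>

lemma ext_class_adelic_group:
  assumes A: "rat_extension A i p"
  obtains x where "ext_class A i p = adele_class (adele_of_zhat x)"
    and "A \<cong> adelic_group (adele_of_zhat x)"
proof -
  let ?P = "\<lambda>\<xi>. \<exists>x. \<xi> = adele_class (adele_of_zhat x) \<and>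
     equivalent_extensions A i p (adelic_group (adele_of_zhat x)) adelic_incl adelic_proj"
  obtain x where
    "equivalent_extensions A i p (adelic_group (adele_of_zhat x)) adelic_incl adelic_proj"
    using A by (rule rat_extension_equivalent_adelic_group)
  then have "\<exists>!\<xi>. ?P \<xi>"
    using equivalent_adelic_groups_same_class[OF _ _ A] by blast
  then have "?P (ext_class A i p)" unfolding ext_class_def by (rule theI')
  then show thesis
    using that by (auto simp: equivalent_extensions_def is_iso_def)
qed

section \<open>Isomorphism classes and orbits\<close>

theorem proposition21:
  fixes A :: "'a monoid" and i :: "int \<Rightarrow> 'a" and p :: "'a \<Rightarrow> rat"
    and A' :: "'b monoid" and i' :: "int \<Rightarrow> 'b" and p' :: "'b \<Rightarrow> rat"
  assumes "rat_extension A i p" and "rat_extension A' i' p'"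
  shows "A \<cong> A' \<longleftrightarrow> same_orbit (ext_class A i p) (ext_class A' i' p')"
proof -
  interpret A: comm_group A using assms(1) by (simp add: rat_extension_def)
  interpret A': comm_group A' using assms(2) by (simp add: rat_extension_def)
  obtain x where x: "ext_class A i p = adele_class (adele_of_zhat x)"
    "A \<cong> adelic_group (adele_of_zhat x)"
    by (rule ext_class_adelic_group[OF assms(1)])
  obtain y where y: "ext_class A' i' p' = adele_class (adele_of_zhat y)"
    "A' \<cong> adelic_group (adele_of_zhat y)"
    by (rule ext_class_adelic_group[OF assms(2)])
  show ?thesis
  proof
    assume "A \<cong> A'"
    have "adelic_group (adele_of_zhat y) \<cong> A'" using y(2) by (rule A'.iso_sym)
    also have "A' \<cong> A" using \<open>A \<cong> A'\<close> by (rule A.iso_sym)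
    also note x(2)
    finally obtain g where "moebius (adele_of_zhat x) g = Some (adele_of_zhat y)"
      using adelic_group_iso_imp_moebius by blast
    then show "same_orbit (ext_class A i p) (ext_class A' i' p')"
      unfolding same_orbit_def x(1) y(1) by blast
  next
    assume "same_orbit (ext_class A i p) (ext_class A' i' p')"
    then obtain z z' g where z: "adele_class z = adele_class (adele_of_zhat x)"
      and z': "adele_class (adele_of_zhat y) = adele_class z'" and g: "moebius z g = Some z'"
      unfolding same_orbit_def x(1) y(1) by metis
    note y(2)
    also have "adelic_group (adele_of_zhat y) \<cong> adelic_group z'"
      using z' by (rule adelic_group_iso_same_class)
    also have "adelic_group z' \<cong> adelic_group z"
      using g by (rule moebius_eq_SomeD) (rule adelic_group_iso_moebius)
    also have "adelic_group z \<cong> adelic_group (adele_of_zhat x)"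
      using z by (rule adelic_group_iso_same_class)
    also have "adelic_group (adele_of_zhat x) \<cong> A" using x(2) by (rule A.iso_sym)
    finally show "A \<cong> A'" by (rule A'.iso_sym)
  qed
qed

end
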